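(* Let $k,l,m,n$ be integers such that $n=k(m-l)+l$, where $k\geq 1$, $m\geq 2$ and $1\le l<\lceil \frac{m}{2}\rceil$. Let $K$ be a field, $R=K[x_1,\dots,x_n]$, and let $I_{m,l,k}=(u_1,\dots,u_k)\subseteq R$ with $u_i=\prod_{j=1}^{m}x_{(i-1)(m-l)+j}$ for $1\leq i\leq k$. Then $\mathrm{depth}(I_{m,l,k})=n-k+1$.
   Context: $R$ is graded in the standard way ($\deg x_i=1$), and $\lceil a\rceil$ denotes the smallest integer $\ge a$. Here $\mathrm{depth}(I)$ denotes the depth of the ideal $I$ viewed as a graded $R$-module (with respect to the homogeneous maximal ideal $(x_1,\dots,x_n)$), not the depth of $R/I$. *)

theory Defs
  imports
    "HOL-Algebra.Module"
    "HOL-Algebra.Ideal"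
    "HOL-Library.Poly_Mapping"
    "HOL-Library.Extended_Nat"
begin

(* A polynomial is a finitely supported map from monomials to coefficients, and a monomial is a
   finitely supported map from variable indices to exponents. *)
type_synonym 'k mpoly = "(nat \<Rightarrow>\<^sub>0 nat) \<Rightarrow>\<^sub>0 'k"

definition Var :: "nat \<Rightarrow> 'k::comm_ring_1 mpoly" where
  "Var j = Poly_Mapping.single (Poly_Mapping.single j 1) 1"

(* The type mpoly has infinitely many variables x_0, x_1, ...; the ring K[x_1,...,x_n] is cut out
   by its carrier, the polynomials whose monomials involve only x_1, ..., x_n. *)
definition poly_ring :: "nat \<Rightarrow> 'k::comm_ring_1 mpoly ring" where
  "poly_ring n =
     \<lparr>carrier = {p. \<forall>t \<in> Poly_Mapping.keys p. Poly_Mapping.keys t \<subseteq> {1..n}},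
      mult = (*), one = 1, zero = 0, add = (+)\<rparr>"

definition homogeneous_maximal_ideal :: "nat \<Rightarrow> 'k::comm_ring_1 mpoly set" where
  "homogeneous_maximal_ideal n = genideal (poly_ring n) (Var ` {1..n})"

definition ideal_module :: "('a, 'c) ring_scheme \<Rightarrow> 'a set \<Rightarrow> ('a, 'a) module" where
  "ideal_module R I =
     \<lparr>carrier = I, mult = mult R, one = one R, zero = zero R, add = add R, smult = mult R\<rparr>"

(* The submodule (f_1,...,f_r)M. *)
definition ideal_times_module :: "('a, 'b, 'd) module_scheme \<Rightarrow> 'a list \<Rightarrow> 'b set" where
  "ideal_times_module M fs =
     {(\<Oplus>\<^bsub>M\<^esub>i\<in>{..<length fs}. fs ! i \<odot>\<^bsub>M\<^esub> y i) | y. y \<in> {..<length fs} \<rightarrow> carrier M}"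

(* With 0-based i, the first condition says that f_i is a non-zero-divisor on
   M/(f_0,...,f_(i-1))M, spelled out on representatives; the second one that M/(f_0,...,f_(r-1))M
   is nonzero. *)
definition regular_sequence :: "('a, 'b, 'd) module_scheme \<Rightarrow> 'a list \<Rightarrow> bool" where
  "regular_sequence M fs \<longleftrightarrow>
     (\<forall>i < length fs. \<forall>y \<in> carrier M.
        fs ! i \<odot>\<^bsub>M\<^esub> y \<in> ideal_times_module M (take i fs) \<longrightarrow>
        y \<in> ideal_times_module M (take i fs)) \<and>
     ideal_times_module M fs \<noteq> carrier M"

(* Depth of M with respect to the ideal J: the supremum of the lengths of M-regular sequences
   in J. The elements of J need not be homogeneous. *)
definition module_depth :: "'a set \<Rightarrow> ('a, 'b, 'd) module_scheme \<Rightarrow> enat" where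
  "module_depth J M = Sup {enat (length fs) | fs. set fs \<subseteq> J \<and> regular_sequence M fs}"

definition path_generator :: "nat \<Rightarrow> nat \<Rightarrow> nat \<Rightarrow> 'k::comm_ring_1 mpoly" where
  "path_generator m l i = (\<Prod>j=1..m. Var ((i - 1) * (m - l) + j))"

definition path_ideal :: "nat \<Rightarrow> nat \<Rightarrow> nat \<Rightarrow> nat \<Rightarrow> 'k::comm_ring_1 mpoly set" where
  "path_ideal n m l k = genideal (poly_ring n) (path_generator m l ` {1..k})"

lemma cring_poly_ring: "cring (poly_ring n :: 'k::comm_ring_1 mpoly ring)"
proof (rule cringI)
  show "abelian_group (poly_ring n :: 'k mpoly ring)"
  proof (rule abelian_groupI)
    fix p :: "'k mpoly" assume "p \<in> carrier (poly_ring n)"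
    then show "\<exists>q \<in> carrier (poly_ring n). q \<oplus>\<^bsub>poly_ring n\<^esub> p = \<zero>\<^bsub>poly_ring n\<^esub>"
      by (intro bexI[of _ "- p"]) (auto simp: poly_ring_def)
  next
    fix p q :: "'k mpoly"
    assume "p \<in> carrier (poly_ring n)" "q \<in> carrier (poly_ring n)"
    then show "p \<oplus>\<^bsub>poly_ring n\<^esub> q \<in> carrier (poly_ring n)"
      using keys_add[of p q] by (auto simp: poly_ring_def)
  qed (auto simp: poly_ring_def ac_simps)
  show "comm_monoid (poly_ring n :: 'k mpoly ring)"
  proof (rule comm_monoidI)
    fix p q :: "'k mpoly"
    assume "p \<in> carrier (poly_ring n)" "q \<in> carrier (poly_ring n)"
    then have pq: "\<forall>t \<in> Poly_Mapping.keys p. Poly_Mapping.keys t \<subseteq> {1..n}"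
      "\<forall>t \<in> Poly_Mapping.keys q. Poly_Mapping.keys t \<subseteq> {1..n}"
      by (simp_all add: poly_ring_def)
    have "Poly_Mapping.keys t \<subseteq> {1..n}" if t: "t \<in> Poly_Mapping.keys (p * q)" for t
    proof -
      obtain a b where "t = a + b" "a \<in> Poly_Mapping.keys p" "b \<in> Poly_Mapping.keys q"
        using subsetD[OF keys_mult t] by blast
      then show ?thesis
        using pq keys_add[of a b] by blast
    qed
    then show "p \<otimes>\<^bsub>poly_ring n\<^esub> q \<in> carrier (poly_ring n)"
      by (simp add: poly_ring_def)
  qed (auto simp: poly_ring_def ac_simps)
qed (simp add: poly_ring_def distrib_right)

lemma Var_in_poly_ring: "j \<in> {1..n} \<Longrightarrow> Var j \<in> carrier (poly_ring n)"
  by (auto simp: Var_def poly_ring_def)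

lemma module_ideal_module:
  fixes R (structure)
  assumes "cring R" "ideal I R"
  shows "Module.module R (ideal_module R I)"
proof -
  interpret cring R by fact
  interpret I: ideal I R by fact
  show ?thesis
  proof (rule Module.moduleI)
    show "abelian_group (ideal_module R I)"
    proof (rule abelian_groupI)
      fix x assume "x \<in> carrier (ideal_module R I)"
      then show "\<exists>y \<in> carrier (ideal_module R I). y \<oplus>\<^bsub>ideal_module R I\<^esub> x = \<zero>\<^bsub>ideal_module R I\<^esub>"
        by (intro bexI[of _ "\<ominus> x"]) (auto simp: ideal_module_def I.Icarr l_neg)
    qed (auto simp: ideal_module_def I.Icarr a_ac)
  qed (auto simp: ideal_module_def I.Icarr I.I_l_closed l_distr r_distr m_assoc assms(1))
qed

lemma path_generator_in_poly_ring:
  assumes "n = k * (m - l) + l" "l \<le> m" "i \<in> {1..k}"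
  shows "path_generator m l i \<in> carrier (poly_ring n :: 'k::comm_ring_1 mpoly ring)"
proof -
  interpret cring "poly_ring n :: 'k mpoly ring" by (rule cring_poly_ring)
  have "(i - 1) * (m - l) + j \<in> {1..n}" if "j \<in> {1..m}" for j
  proof -
    have "(i - 1) * (m - l) + (m - l) = i * (m - l)"
      using assms(3) by (cases i) auto
    also have "\<dots> \<le> k * (m - l)"
      using assms(3) by simp
    finally show ?thesis
      using assms(1,2) that by auto
  qed
  moreover have "(\<Prod>j\<in>A. p j) \<in> carrier (poly_ring n)"
    if "finite A" "\<forall>j\<in>A. p j \<in> carrier (poly_ring n)" for A and p :: "nat \<Rightarrow> 'k mpoly"
    using that
  proof (induction A rule: finite_induct)
    case empty
    show ?case using one_closed by (simp add: poly_ring_def)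
  next
    case (insert a A)
    then show ?case using m_closed[of "p a" "prod p A"] by (simp add: poly_ring_def)
  qed
  ultimately show ?thesis
    unfolding path_generator_def by (meson Var_in_poly_ring finite_atLeastAtMost)
qed

lemma ideal_path_ideal:
  assumes "n = k * (m - l) + l" "l \<le> m"
  shows "ideal (path_ideal n m l k) (poly_ring n :: 'k::comm_ring_1 mpoly ring)"
proof -
  interpret cring "poly_ring n :: 'k mpoly ring" by (rule cring_poly_ring)
  show ?thesis
    unfolding path_ideal_def
    using path_generator_in_poly_ring[OF assms] by (intro genideal_ideal) blast
qed

end

theory Submission
  imports Defs
begin

text \<open>
  Identifying variables turns \<open>I = (u\<^sub>1, \<dots>, u\<^sub>k)\<close> into a monomial ideal \<open>I'\<close> in \<open>k\<close> variables
  \<open>y\<^sub>1, \<dots>, y\<^sub>k\<close> of which \<open>I\<close> is the polarization. The supports of the generators are nested in every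
  class of identified variables, so the least common multiples are preserved, and therefore the
  \<open>n - k\<close> differences of identified variables form an \<open>I\<close>-regular sequence, with quotient \<open>I'\<close>. As \<open>I'\<close>
  is torsion-free, \<open>y\<^sub>1\<close> extends it to a regular sequence of length \<open>n - k + 1\<close>. Writing \<open>L\<close> for the
  least common multiple of the generators of \<open>I'\<close>, the monomial \<open>L / (y\<^sub>2 \<cdots> y\<^sub>k)\<close> is a nonzero
  element of \<open>I' / y\<^sub>1 I'\<close> killed by all variables.

  Such an element shows that no regular sequence in the homogeneous maximal ideal is longer. It is
  a nonzero class in the top Koszul homology of the quotient module; removing one element from a
  regular sequence lowers the degree of a nonvanishing Koszul homology group by at most one, whereas
  adding one element raises it by one, because multiplication by an element of
  \<open>(x\<^sub>1, \<dots>, x\<^sub>n)\<close> is zero on Koszul homology.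
\<close>

section \<open>Koszul homology and regular sequences\<close>

text \<open>Counterpart of \<open>ideal_times_module\<close> in which the operations of the type
  replace those of the record, so that ordinary ring arithmetic applies.\<close>

definition ideal_times :: "'a::comm_ring_1 set \<Rightarrow> 'a list \<Rightarrow> 'a set" where
  "ideal_times M fs = {\<Sum>i<length fs. fs ! i * y i | y. \<forall>i<length fs. y i \<in> M}"

text \<open>Injectivity of multiplication by \<open>f\<close> on \<open>M / N\<close>, phrased on
  representatives so that no quotient has to be built.\<close>

definition nonzerodivisor_mod :: "'a::comm_ring_1 set \<Rightarrow> 'a set \<Rightarrow> 'a \<Rightarrow> bool" where
  "nonzerodivisor_mod M N f \<longleftrightarrow> (\<forall>y\<in>M. f * y \<in> N \<longrightarrow> y \<in> N)"

lemma ideal_times_Nil [simp]: "ideal_times M [] = {0}"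
  by (auto simp: ideal_times_def)

text \<open>Sequences are processed from the right: every later induction sees only the passage from
  a submodule \<open>N\<close> to \<open>N + f M\<close>.\<close>

lemma ideal_times_snoc:
  "ideal_times M (fs @ [f]) = {a + f * y | a y. a \<in> ideal_times M fs \<and> y \<in> M}"
proof (intro equalityI subsetI)
  fix p assume "p \<in> ideal_times M (fs @ [f])"
  then obtain y where y: "\<forall>i<Suc (length fs). y i \<in> M"
    "p = (\<Sum>i<Suc (length fs). (fs @ [f]) ! i * y i)"
    by (auto simp: ideal_times_def)
  have "p = (\<Sum>i<length fs. fs ! i * y i) + f * y (length fs)"
    using y(2) by (simp add: nth_append)
  then show "p \<in> {a + f * y | a y. a \<in> ideal_times M fs \<and> y \<in> M}"
    using y(1) unfolding ideal_times_def by fastforce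
next
  fix p assume "p \<in> {a + f * y | a y. a \<in> ideal_times M fs \<and> y \<in> M}"
  then obtain y z where y: "\<forall>i<length fs. y i \<in> M" "z \<in> M"
    "p = (\<Sum>i<length fs. fs ! i * y i) + f * z"
    by (auto simp: ideal_times_def)
  define y' where "y' = y(length fs := z)"
  have "p = (\<Sum>i<length (fs @ [f]). (fs @ [f]) ! i * y' i)"
    using y(3) by (simp add: nth_append y'_def)
  moreover have "\<forall>i<length (fs @ [f]). y' i \<in> M"
    using y by (auto simp: y'_def less_Suc_eq)
  ultimately show "p \<in> ideal_times M (fs @ [f])"
    unfolding ideal_times_def by blast
qed

definition regular_on :: "'a::comm_ring_1 set \<Rightarrow> 'a list \<Rightarrow> bool" where
  "regular_on M fs \<longleftrightarrow>
     (\<forall>i<length fs. nonzerodivisor_mod M (ideal_times M (take i fs)) (fs ! i))"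

lemma regular_on_snoc:
  "regular_on M (fs @ [f]) \<longleftrightarrow> regular_on M fs \<and> nonzerodivisor_mod M (ideal_times M fs) f"
  by (auto simp: regular_on_def nth_append less_Suc_eq)

lemma ideal_times_member:
  assumes "0 \<in> M" "f \<in> set fs" "y \<in> M"
  shows "f * y \<in> ideal_times M fs"
proof -
  obtain i where i: "i < length fs" "f = fs ! i"
    using assms(2) by (metis in_set_conv_nth)
  have "f * y = (\<Sum>j<length fs. fs ! j * (if j = i then y else 0))"
    using i by (simp add: if_distrib sum.delta cong: if_cong)
  then show ?thesis
    unfolding ideal_times_def using assms by force
qed

section \<open>The Koszul differential and its homotopy\<close>

text \<open>The sign that sorts the basis vector of \<open>j\<close> into the exterior product of
  the basis vectors indexed by \<open>S\<close>.\<close>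

definition koszul_sign :: "nat \<Rightarrow> nat set \<Rightarrow> 'a::comm_ring_1" where
  "koszul_sign j S = (- 1) ^ card {i \<in> S. i < j}"

text \<open>A chain is given by its coefficients on the exterior basis, so the differential is read
  off at a target \<open>S\<close>: it collects the sets from which removing one index leaves
  \<open>S\<close>.\<close>

definition koszul_d :: "nat set \<Rightarrow> (nat \<Rightarrow> 'a) \<Rightarrow> (nat set \<Rightarrow> 'a) \<Rightarrow> nat set \<Rightarrow> 'a::comm_ring_1" where
  "koszul_d X x c S = (\<Sum>j\<in>X - S. koszul_sign j S * x j * c (insert j S))"

text \<open>Left exterior multiplication by the vector with entries \<open>g j\<close>.\<close>

definition koszul_h :: "nat set \<Rightarrow> (nat \<Rightarrow> 'a) \<Rightarrow> (nat set \<Rightarrow> 'a) \<Rightarrow> nat set \<Rightarrow> 'a::comm_ring_1" where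
  "koszul_h X g c S = (\<Sum>j\<in>X \<inter> S. koszul_sign j (S - {j}) * g j * c (S - {j}))"

lemma koszul_sign_insert:
  assumes "finite S" "j \<notin> S"
  shows "koszul_sign i (insert j S) = (if j < i then - koszul_sign i S else koszul_sign i S)"
proof -
  have "{a \<in> insert j S. a < i} = (if j < i then insert j {a \<in> S. a < i} else {a \<in> S. a < i})"
    by auto
  then show ?thesis
    using assms by (simp add: koszul_sign_def)
qed

lemma koszul_sign_square [simp]: "koszul_sign j S * koszul_sign j S = 1"
  by (simp add: koszul_sign_def flip: power_mult_distrib)

text \<open>Swapping the two indices would only show that twice the sum is zero, which says nothing
  in characteristic 2. The induction instead cancels the row of the new index against its
  column.\<close>

lemma sum_antisymmetric_off_diagonal:
  fixes F :: "'b \<Rightarrow> 'b \<Rightarrow> 'a::comm_ring_1"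
  assumes "finite A" "\<And>i j. i \<in> A \<Longrightarrow> j \<in> A \<Longrightarrow> i \<noteq> j \<Longrightarrow> F i j = - F j i"
  shows "(\<Sum>j\<in>A. \<Sum>i\<in>A - {j}. F j i) = 0"
  using assms
proof (induction A rule: finite_induct)
  case (insert a A)
  have "(\<Sum>j\<in>A. \<Sum>i\<in>insert a A - {j}. F j i) = (\<Sum>j\<in>A. F j a + (\<Sum>i\<in>A - {j}. F j i))"
  proof (rule sum.cong)
    fix j assume "j \<in> A"
    then have "insert a A - {j} = insert a (A - {j})"
      using insert.hyps by auto
    then show "(\<Sum>i\<in>insert a A - {j}. F j i) = F j a + (\<Sum>i\<in>A - {j}. F j i)"
      using insert.hyps by simp
  qed simp
  also have "\<dots> = (\<Sum>j\<in>A. F j a) + (\<Sum>j\<in>A. \<Sum>i\<in>A - {j}. F j i)"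
    by (rule sum.distrib)
  also have "(\<Sum>j\<in>A. \<Sum>i\<in>A - {j}. F j i) = 0"
    by (intro insert.IH insert.prems) auto
  also have "(\<Sum>j\<in>A. F j a) = (\<Sum>j\<in>A. - F a j)"
    using insert.hyps by (intro sum.cong refl insert.prems) auto
  finally have rest: "(\<Sum>j\<in>A. \<Sum>i\<in>insert a A - {j}. F j i) = - (\<Sum>j\<in>A. F a j)"
    by (simp add: sum_negf)
  have "insert a A - {a} = A"
    using insert.hyps by blast
  then show ?case
    unfolding sum.insert[OF insert.hyps] rest by simp
qed simp

text \<open>Two indices removed in either order contribute the same product with opposite
  signs.\<close>

lemma koszul_d_d:
  assumes "finite X" "finite S"
  shows "koszul_d X x (koszul_d X x c) S = 0"
proof -
  define F where "F j i = koszul_sign j S * x j *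
    (koszul_sign i (insert j S) * x i * c (insert i (insert j S)))" for i j
  have "koszul_d X x (koszul_d X x c) S = (\<Sum>j\<in>X - S. \<Sum>i\<in>X - S - {j}. F j i)"
    unfolding koszul_d_def F_def sum_distrib_left
    by (intro sum.cong refl) auto
  also have "\<dots> = 0"
  proof (rule sum_antisymmetric_off_diagonal)
    fix i j assume ij: "i \<in> X - S" "j \<in> X - S" "i \<noteq> j"
    then have "insert i (insert j S) = insert j (insert i S)"
      by auto
    then show "F i j = - F j i"
      using ij assms(2) by (auto simp: F_def koszul_sign_insert)
  qed (use assms in simp)
  finally show ?thesis .
qed

text \<open>Adding and removing the same index gives \<open>x j * g j * c S\<close>, because the
  sign squares to one; terms with two different indices cancel. Hence every combination of the
  \<open>x j\<close> acts as zero on homology.\<close>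

lemma koszul_homotopy:
  assumes "finite X" "finite S"
  shows "koszul_d X x (koszul_h X g c) S + koszul_h X g (koszul_d X x c) S
    = (\<Sum>j\<in>X. x j * g j) * c S"
proof -
  \<comment> \<open>\<open>A\<close> and \<open>B\<close> are the mixed terms of the two
    compositions: both read \<open>c\<close> at \<open>S\<close> with \<open>i\<close> added and
    \<open>j\<close> removed, in the two possible orders.\<close>
  define A where "A i j = koszul_sign i S * x i *
    (koszul_sign j (insert i S - {j}) * g j * c (insert i S - {j}))" for i j
  define B where "B i j = koszul_sign j (S - {j}) * g j *
    (koszul_sign i (S - {j}) * x i * c (insert i (S - {j})))" for i j
  have AB: "A i j + B i j = 0" if "i \<notin> S" "j \<in> S" for i j
  proof -
    have ne: "i \<noteq> j" and ins: "insert j (S - {j}) = S"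
      and iS: "insert i S - {j} = insert i (S - {j})"
      using that by auto
    have "koszul_sign i S = (if j < i then - koszul_sign i (S - {j}) else koszul_sign i (S - {j}) :: 'a)"
      using koszul_sign_insert[of "S - {j}" j i] assms(2) unfolding ins by simp
    moreover have "koszul_sign j (insert i (S - {j}))
      = (if i < j then - koszul_sign j (S - {j}) else koszul_sign j (S - {j}) :: 'a)"
      using koszul_sign_insert[of "S - {j}" i j] assms(2) that by simp
    ultimately show ?thesis
      unfolding A_def B_def iS using ne by auto
  qed
  have d_h: "koszul_d X x (koszul_h X g c) S = (\<Sum>i\<in>X - S. x i * g i * c S + (\<Sum>j\<in>X \<inter> S. A i j))"
    unfolding koszul_d_def koszul_h_def
  proof (rule sum.cong)
    fix i assume i: "i \<in> X - S"
    then have "X \<inter> insert i S = insert i (X \<inter> S)" "insert i S - {i} = S"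
      by auto
    then have "koszul_sign i S * x i * (\<Sum>j\<in>X \<inter> insert i S.
        koszul_sign j (insert i S - {j}) * g j * c (insert i S - {j}))
      = koszul_sign i S * x i * (koszul_sign i S * g i * c S) + (\<Sum>j\<in>X \<inter> S. A i j)"
      using i assms by (simp add: A_def distrib_left sum_distrib_left)
    also have "koszul_sign i S * x i * (koszul_sign i S * g i * c S)
      = (koszul_sign i S * koszul_sign i S) * (x i * g i * c S)"
      by (simp only: ac_simps)
    finally show "koszul_sign i S * x i * (\<Sum>j\<in>X \<inter> insert i S.
        koszul_sign j (insert i S - {j}) * g j * c (insert i S - {j}))
      = x i * g i * c S + (\<Sum>j\<in>X \<inter> S. A i j)" by simp
  qed simp
  have h_d: "koszul_h X g (koszul_d X x c) S
    = (\<Sum>j\<in>X \<inter> S. x j * g j * c S + (\<Sum>i\<in>X - S. B i j))"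
    unfolding koszul_d_def koszul_h_def
  proof (rule sum.cong)
    fix j assume j: "j \<in> X \<inter> S"
    then have "X - (S - {j}) = insert j (X - S)" "insert j (S - {j}) = S"
      by auto
    then have "koszul_sign j (S - {j}) * g j *
        (\<Sum>i\<in>X - (S - {j}). koszul_sign i (S - {j}) * x i * c (insert i (S - {j})))
      = koszul_sign j (S - {j}) * g j * (koszul_sign j (S - {j}) * x j * c S) + (\<Sum>i\<in>X - S. B i j)"
      using j assms by (simp add: B_def distrib_left sum_distrib_left)
    also have "koszul_sign j (S - {j}) * g j * (koszul_sign j (S - {j}) * x j * c S)
      = (koszul_sign j (S - {j}) * koszul_sign j (S - {j})) * (x j * g j * c S)"
      by (simp only: ac_simps)
    finally show "koszul_sign j (S - {j}) * g j *
        (\<Sum>i\<in>X - (S - {j}). koszul_sign i (S - {j}) * x i * c (insert i (S - {j})))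
      = x j * g j * c S + (\<Sum>i\<in>X - S. B i j)" by simp
  qed simp
  have cancel: "(\<Sum>i\<in>X - S. \<Sum>j\<in>X \<inter> S. A i j) + (\<Sum>j\<in>X \<inter> S. \<Sum>i\<in>X - S. B i j) = 0"
  proof -
    have "(\<Sum>j\<in>X \<inter> S. \<Sum>i\<in>X - S. B i j) = (\<Sum>i\<in>X - S. \<Sum>j\<in>X \<inter> S. B i j)"
      by (rule sum.swap)
    then have "(\<Sum>i\<in>X - S. \<Sum>j\<in>X \<inter> S. A i j) + (\<Sum>j\<in>X \<inter> S. \<Sum>i\<in>X - S. B i j)
      = (\<Sum>i\<in>X - S. \<Sum>j\<in>X \<inter> S. A i j + B i j)"
      by (simp add: sum.distrib)
    also have "\<dots> = 0"
      using AB by (intro sum.neutral ballI) auto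
    finally show ?thesis .
  qed
  have split: "(\<Sum>j\<in>X. x j * g j * c S)
    = (\<Sum>i\<in>X - S. x i * g i * c S) + (\<Sum>j\<in>X \<inter> S. x j * g j * c S)"
    using sum.Int_Diff[OF assms(1), of "\<lambda>j. x j * g j * c S" S] by (simp add: add.commute)
  have "koszul_d X x (koszul_h X g c) S + koszul_h X g (koszul_d X x c) S
    = ((\<Sum>i\<in>X - S. x i * g i * c S) + (\<Sum>j\<in>X \<inter> S. x j * g j * c S))
      + ((\<Sum>i\<in>X - S. \<Sum>j\<in>X \<inter> S. A i j) + (\<Sum>j\<in>X \<inter> S. \<Sum>i\<in>X - S. B i j))"
    unfolding d_h h_d sum.distrib by (simp only: ac_simps)
  then show ?thesis
    unfolding cancel split[symmetric] by (simp add: sum_distrib_right)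
qed

lemma koszul_d_diff:
  "koszul_d X x (\<lambda>S. b S - c S) S = koszul_d X x b S - koszul_d X x c S"
  by (simp add: koszul_d_def right_diff_distrib sum_subtractf)

lemma koszul_d_scale:
  "koszul_d X x (\<lambda>S. f * c S) S = f * koszul_d X x c S"
  by (simp add: koszul_d_def sum_distrib_left ac_simps)

section \<open>Chains and homology with coefficients in a quotient\<close>

definition koszul_chains :: "nat set \<Rightarrow> 'a set \<Rightarrow> nat \<Rightarrow> (nat set \<Rightarrow> 'a::comm_ring_1) set" where
  "koszul_chains X M p = {c. (\<forall>S. c S \<in> M) \<and> (\<forall>S. c S \<noteq> 0 \<longrightarrow> S \<subseteq> X \<and> card S = p)}"

text \<open>\<open>H\<^sub>p(x; M/N) \<noteq> 0\<close>, where cycles and boundaries of \<open>M/N\<close> are represented by chains with values in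
  \<open>M\<close>.\<close>
definition koszul_homology_nonzero ::
  "nat set \<Rightarrow> (nat \<Rightarrow> 'a::comm_ring_1) \<Rightarrow> 'a set \<Rightarrow> 'a set \<Rightarrow> nat \<Rightarrow> bool" where
  "koszul_homology_nonzero X x M N p \<longleftrightarrow>
     (\<exists>c \<in> koszul_chains X M p. (\<forall>S. koszul_d X x c S \<in> N) \<and>
        \<not> (\<exists>e \<in> koszul_chains X M (Suc p). \<forall>S. c S - koszul_d X x e S \<in> N))"

text \<open>\<open>M\<close> stands for a module over scalars \<open>R\<close>, both inside one
  ambient ring; the scalar \<open>- 1\<close> supplies additive inverses.\<close>

locale subset_module =
  fixes R M :: "'a::comm_ring_1 set"
  assumes minus_one_scalar: "- 1 \<in> R"
    and zero_mem: "0 \<in> M"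
    and add_mem: "\<And>y z. y \<in> M \<Longrightarrow> z \<in> M \<Longrightarrow> y + z \<in> M"
    and scale_mem: "\<And>r y. r \<in> R \<Longrightarrow> y \<in> M \<Longrightarrow> r * y \<in> M"
begin

lemma uminus_mem: "y \<in> M \<Longrightarrow> - y \<in> M"
  using scale_mem[OF minus_one_scalar, of y] by simp

lemma diff_mem: "y \<in> M \<Longrightarrow> z \<in> M \<Longrightarrow> y - z \<in> M"
  using add_mem[OF _ uminus_mem, of y z] by simp

lemma sum_mem: "(\<And>i. i \<in> A \<Longrightarrow> y i \<in> M) \<Longrightarrow> sum y A \<in> M"
  by (induction A rule: infinite_finite_induct) (auto intro: zero_mem add_mem)

lemma sign_scale_mem: "y \<in> M \<Longrightarrow> koszul_sign j S * y \<in> M"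
  using uminus_mem[of y] by (cases "even (card {i \<in> S. i < j})") (auto simp: koszul_sign_def)

lemma koszul_d_mem:
  assumes "\<And>j. j \<in> X \<Longrightarrow> x j \<in> R" "\<And>T. T \<subseteq> S \<union> X \<Longrightarrow> c T \<in> M"
  shows "koszul_d X x c S \<in> M"
  unfolding koszul_d_def mult.assoc
proof (rule sum_mem)
  fix j assume "j \<in> X - S"
  then have "x j * c (insert j S) \<in> M"
    by (intro scale_mem[OF assms(1) assms(2)]) auto
  then show "koszul_sign j S * (x j * c (insert j S)) \<in> M"
    by (rule sign_scale_mem)
qed

lemma koszul_h_mem:
  assumes "\<And>j. j \<in> X \<Longrightarrow> g j \<in> R" "\<And>S. c S \<in> M"
  shows "koszul_h X g c S \<in> M"
  unfolding koszul_h_def mult.assoc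
proof (rule sum_mem)
  fix j assume "j \<in> X \<inter> S"
  then have "g j * c (S - {j}) \<in> M"
    by (intro scale_mem[OF assms(1) assms(2)]) auto
  then show "koszul_sign j (S - {j}) * (g j * c (S - {j})) \<in> M"
    by (rule sign_scale_mem)
qed

lemma koszul_h_chain:
  assumes "finite X" "c \<in> koszul_chains X M p" "\<And>j. j \<in> X \<Longrightarrow> g j \<in> R"
  shows "koszul_h X g c \<in> koszul_chains X M (Suc p)"
proof -
  have "S \<subseteq> X \<and> card S = Suc p" if nz: "koszul_h X g c S \<noteq> 0" for S
  proof -
    obtain j where "j \<in> X \<inter> S" "koszul_sign j (S - {j}) * g j * c (S - {j}) \<noteq> 0"
      using nz unfolding koszul_h_def by (rule sum.not_neutral_contains_not_neutral)
    then have j: "j \<in> X \<inter> S" "c (S - {j}) \<noteq> 0"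
      by auto
    then have S: "S - {j} \<subseteq> X" "card (S - {j}) = p"
      using assms(2) by (auto simp: koszul_chains_def)
    then have "finite S" using finite_subset[OF S(1) assms(1)] by simp
    then show ?thesis
      using S j card.remove[of S j] by auto
  qed
  then show ?thesis
    using assms koszul_h_mem[of X g c] by (auto simp: koszul_chains_def)
qed

lemma koszul_d_chain:
  assumes "finite X" "c \<in> koszul_chains X M (Suc p)" "\<And>j. j \<in> X \<Longrightarrow> x j \<in> R"
  shows "koszul_d X x c \<in> koszul_chains X M p"
proof -
  have "S \<subseteq> X \<and> card S = p" if nz: "koszul_d X x c S \<noteq> 0" for S
  proof -
    obtain j where "j \<in> X - S" "koszul_sign j S * x j * c (insert j S) \<noteq> 0"
      using nz unfolding koszul_d_def by (rule sum.not_neutral_contains_not_neutral)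
    then have j: "j \<in> X - S" "c (insert j S) \<noteq> 0"
      by auto
    then have S: "insert j S \<subseteq> X" "card (insert j S) = Suc p"
      using assms(2) by (auto simp: koszul_chains_def)
    then have "finite S" using assms(1) finite_subset by auto
    then show ?thesis
      using S j by auto
  qed
  then show ?thesis
    using assms koszul_d_mem[of X x _ c] by (auto simp: koszul_chains_def)
qed

lemma koszul_d_degree_zero:
  assumes "finite X" "c \<in> koszul_chains X M 0"
  shows "koszul_d X x c S = 0"
proof -
  have "c (insert j S) = 0" if "j \<in> X" for j
  proof (rule ccontr)
    assume "c (insert j S) \<noteq> 0"
    then have "insert j S \<subseteq> X" "card (insert j S) = 0"
      using assms(2) by (auto simp: koszul_chains_def)
    then show False
      using assms(1) by (metis card_0_eq empty_not_insert finite_subset)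
  qed
  then show ?thesis by (simp add: koszul_d_def)
qed

lemma chain_zero_outside: "c \<in> koszul_chains X M p \<Longrightarrow> \<not> S \<subseteq> X \<Longrightarrow> c S = 0"
  by (auto simp: koszul_chains_def)

lemma koszul_d_zero_outside:
  "c \<in> koszul_chains X M p \<Longrightarrow> \<not> S \<subseteq> X \<Longrightarrow> koszul_d X x c S = 0"
  unfolding koszul_d_def by (intro sum.neutral ballI) (simp add: chain_zero_outside)

lemma coset_rep: "p \<in> {a + f * y | a y. a \<in> N \<and> y \<in> M} \<Longrightarrow> \<exists>y. y \<in> M \<and> p - f * y \<in> N"
  by auto

section \<open>Koszul homology under adding or removing a regular element\<close>

text \<open>In the long exact sequence of multiplication by \<open>f\<close> on
  \<open>M / N\<close>, the map \<open>f\<close> is zero on homology, so the connecting map from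
  degree \<open>Suc p\<close> onto degree \<open>p\<close> is surjective. An explicit preimage of
  the class of \<open>c\<close> is \<open>koszul_h X g c\<close>.\<close>

lemma koszul_homology_regular_up:
  assumes X: "finite X" "\<And>j. j \<in> X \<Longrightarrow> x j \<in> R" "\<And>j. j \<in> X \<Longrightarrow> g j \<in> R"
    and f: "f = (\<Sum>j\<in>X. x j * g j)"
    and N: "subset_module R N" "N \<subseteq> M"
    and nzd: "nonzerodivisor_mod M N f"
    and nonzero: "koszul_homology_nonzero X x M N p"
  shows "koszul_homology_nonzero X x M {a + f * y | a y. a \<in> N \<and> y \<in> M} (Suc p)"
proof -
  interpret N: subset_module R N by (rule N)
  obtain c where c: "c \<in> koszul_chains X M p" "\<And>S. koszul_d X x c S \<in> N"
    and nb: "\<And>e. e \<in> koszul_chains X M (Suc p) \<Longrightarrow> \<not> (\<forall>S. c S - koszul_d X x e S \<in> N)"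
    using nonzero unfolding koszul_homology_nonzero_def by blast
  define b where "b = koszul_h X g c"
  have b: "b \<in> koszul_chains X M (Suc p)"
    unfolding b_def by (rule koszul_h_chain) (use X c in auto)
  have hN: "koszul_h X g (koszul_d X x c) S \<in> N" for S
    by (rule N.koszul_h_mem) (use X c in auto)
  \<comment> \<open>The homotopy formula makes \<open>b\<close> a cycle modulo
    \<open>N + f M\<close> whose boundary is \<open>f * c\<close> modulo \<open>N\<close>.\<close>
  have db: "koszul_d X x b S = f * c S - koszul_h X g (koszul_d X x c) S" if "S \<subseteq> X" for S
    using koszul_homotopy[OF X(1), of S x g c] finite_subset[OF that X(1)]
    by (simp add: b_def f eq_diff_eq)
  have "\<exists>a y. koszul_d X x b S = a + f * y \<and> a \<in> N \<and> y \<in> M" for S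
  proof (cases "S \<subseteq> X")
    case True
    then show ?thesis
      using db[OF True] N.uminus_mem[OF hN] c(1)
      by (intro exI[of _ "- koszul_h X g (koszul_d X x c) S"] exI[of _ "c S"])
        (auto simp: koszul_chains_def)
  next
    case False
    then show ?thesis
      using koszul_d_zero_outside[OF b False] N.zero_mem zero_mem
      by (intro exI[of _ 0]) auto
  qed
  moreover have False
    if e: "e \<in> koszul_chains X M (Suc (Suc p))"
      and be: "\<forall>S. b S - koszul_d X x e S \<in> {a + f * y | a y. a \<in> N \<and> y \<in> M}" for e
  proof -
    have de: "koszul_d X x e \<in> koszul_chains X M (Suc p)"
      by (rule koszul_d_chain) (use X e in auto)
    have "\<forall>S. \<exists>y. y \<in> M \<and> b S - koszul_d X x e S - f * y \<in> N"
      by (intro allI coset_rep be[rule_format])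
    from choice[OF this] obtain y0
      where y0: "\<And>S. y0 S \<in> M" "\<And>S. b S - koszul_d X x e S - f * y0 S \<in> N"
      by blast
    \<comment> \<open>The chosen \<open>y0\<close> has no control on its support. Cutting it off to
      the right degree is harmless, since \<open>b\<close> and the boundary of \<open>e\<close>
      vanish at all other sets.\<close>
    define y where "y S = (if S \<subseteq> X \<and> card S = Suc p then y0 S else 0)" for S
    have y: "y \<in> koszul_chains X M (Suc p)"
      using y0(1) zero_mem by (auto simp: koszul_chains_def y_def)
    define r where "r S = b S - koszul_d X x e S - f * y S" for S
    have r: "r S \<in> N" for S
    proof (cases "S \<subseteq> X \<and> card S = Suc p")
      case True
      then show ?thesis using y0(2)[of S] by (simp add: r_def y_def)
    next
      case False
      then have "b S = 0" "koszul_d X x e S = 0" "y S = 0"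
        using b de by (auto simp: koszul_chains_def y_def)
      then show ?thesis by (simp add: r_def N.zero_mem)
    qed
    have "c S - koszul_d X x y S \<in> N" for S
    proof (cases "S \<subseteq> X")
      case True
      then have fin: "finite S" using X(1) finite_subset by blast
      \<comment> \<open>The boundary of \<open>e\<close> disappears under a second differential.
        What remains says that \<open>f\<close> times \<open>c - koszul_d X x y\<close> lies in
        \<open>N\<close>, and \<open>f\<close> can be cancelled.\<close>
      have "koszul_d X x r S = koszul_d X x b S - f * koszul_d X x y S"
        unfolding r_def koszul_d_diff koszul_d_scale
        using koszul_d_d[OF X(1) fin, of x e] by (simp add: koszul_d_diff)
      then have "f * (c S - koszul_d X x y S) = koszul_d X x r S + koszul_h X g (koszul_d X x c) S"
        using db[OF True] by (simp add: right_diff_distrib)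
      moreover have "koszul_d X x r S \<in> N"
        by (rule N.koszul_d_mem) (use X r in auto)
      ultimately have "f * (c S - koszul_d X x y S) \<in> N"
        using N.add_mem hN by simp
      moreover have "koszul_d X x y S \<in> M"
        by (rule koszul_d_mem) (use X y in \<open>auto simp: koszul_chains_def\<close>)
      then have "c S - koszul_d X x y S \<in> M"
        using c(1) by (auto simp: koszul_chains_def intro: diff_mem)
      ultimately show ?thesis
        using nzd by (auto simp: nonzerodivisor_mod_def)
    next
      case False
      then show ?thesis
        using chain_zero_outside[OF c(1) False] koszul_d_zero_outside[OF y False] N.zero_mem by simp
    qed
    then show False using nb[OF y] by blast
  qed
  ultimately show ?thesis
    unfolding koszul_homology_nonzero_def using b by blast
qed

text \<open>Exactness at the middle of the long exact sequence: if both neighbouring homology groups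
  of \<open>M / N\<close> vanish, so does that of \<open>M / (N + f M)\<close>.\<close>

lemma koszul_homology_regular_down:
  assumes X: "finite X" "\<And>j. j \<in> X \<Longrightarrow> x j \<in> R"
    and f: "f \<in> R"
    and N: "subset_module R N" "N \<subseteq> M"
    and nzd: "nonzerodivisor_mod M N f"
    and nonzero: "koszul_homology_nonzero X x M {a + f * y | a y. a \<in> N \<and> y \<in> M} p"
  shows "koszul_homology_nonzero X x M N p \<or> (\<exists>q. p = Suc q \<and> koszul_homology_nonzero X x M N q)"
proof (rule ccontr)
  assume contra: "\<not> ?thesis"
  interpret N: subset_module R N by (rule N)
  obtain b where b: "b \<in> koszul_chains X M p"
    and dbN: "\<And>S. koszul_d X x b S \<in> {a + f * y | a y. a \<in> N \<and> y \<in> M}"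
    and nb: "\<And>e. e \<in> koszul_chains X M (Suc p) \<Longrightarrow>
      \<not> (\<forall>S. b S - koszul_d X x e S \<in> {a + f * y | a y. a \<in> N \<and> y \<in> M})"
    using nonzero unfolding koszul_homology_nonzero_def by blast
  \<comment> \<open>This is the connecting map: the boundary of \<open>b\<close> is
    \<open>f * c\<close> modulo \<open>N\<close> for a cycle \<open>c\<close>, which is a boundary
    by assumption. In degree 0 the zero chain serves as \<open>e\<close>.\<close>
  have lift: "\<exists>e \<in> koszul_chains X M p. \<forall>S. koszul_d X x b S - f * koszul_d X x e S \<in> N"
  proof (cases p)
    case 0
    have "koszul_d X x b S - f * koszul_d X x (\<lambda>_. 0) S \<in> N" for S
      using koszul_d_degree_zero[of X b x S] X(1) b 0 N.zero_mem by (simp add: koszul_d_def)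
    then show ?thesis
      using zero_mem by (intro bexI[of _ "\<lambda>_. 0"]) (auto simp: koszul_chains_def)
  next
    case (Suc q)
    have db: "koszul_d X x b \<in> koszul_chains X M q"
      by (rule koszul_d_chain) (use X b Suc in auto)
    have "\<forall>S. \<exists>y. y \<in> M \<and> koszul_d X x b S - f * y \<in> N"
      by (intro allI coset_rep dbN)
    from choice[OF this] obtain c0
      where c0: "\<And>S. c0 S \<in> M" "\<And>S. koszul_d X x b S - f * c0 S \<in> N"
      by blast
    define c where "c S = (if S \<subseteq> X \<and> card S = q then c0 S else 0)" for S
    have c: "c \<in> koszul_chains X M q"
      using c0(1) zero_mem by (auto simp: koszul_chains_def c_def)
    define r where "r S = koszul_d X x b S - f * c S" for S
    have r: "r S \<in> N" for S
    proof (cases "S \<subseteq> X \<and> card S = q")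
      case True
      then show ?thesis using c0(2)[of S] by (simp add: r_def c_def)
    next
      case False
      then have "koszul_d X x b S = 0" "c S = 0"
        using db by (auto simp: koszul_chains_def c_def)
      then show ?thesis by (simp add: r_def N.zero_mem)
    qed
    have "koszul_d X x c S \<in> N" for S
    proof (cases "S \<subseteq> X")
      case True
      then have fin: "finite S" using X(1) finite_subset by blast
      have "koszul_d X x r S = - (f * koszul_d X x c S)"
        unfolding r_def koszul_d_diff koszul_d_scale
        using koszul_d_d[OF X(1) fin, of x b] by simp
      moreover have "koszul_d X x r S \<in> N"
        by (rule N.koszul_d_mem) (use X r in auto)
      ultimately have "f * koszul_d X x c S \<in> N"
        using N.uminus_mem by fastforce
      moreover have "koszul_d X x c S \<in> M"
        by (rule koszul_d_mem) (use X c in \<open>auto simp: koszul_chains_def\<close>)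
      ultimately show ?thesis
        using nzd by (auto simp: nonzerodivisor_mod_def)
    next
      case False
      then show ?thesis
        using koszul_d_zero_outside[OF c False] N.zero_mem by simp
    qed
    then obtain e where e: "e \<in> koszul_chains X M p" "\<And>S. c S - koszul_d X x e S \<in> N"
      using contra c Suc unfolding koszul_homology_nonzero_def by blast
    have "koszul_d X x b S - f * koszul_d X x e S \<in> N" for S
    proof -
      have "koszul_d X x b S - f * koszul_d X x e S = r S + f * (c S - koszul_d X x e S)"
        by (simp add: r_def algebra_simps)
      then show ?thesis using r e(2) f N.add_mem N.scale_mem by simp
    qed
    then show ?thesis using e(1) by blast
  qed
  then obtain e where e: "e \<in> koszul_chains X M p"
    "\<And>S. koszul_d X x b S - f * koszul_d X x e S \<in> N"
    by blast
  \<comment> \<open>Subtracting \<open>f * e\<close> keeps the class modulo \<open>N + f M\<close>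
    but turns \<open>b\<close> into a cycle modulo \<open>N\<close>.\<close>
  have "b S - f * e S \<in> M" for S
    using b e(1) by (intro diff_mem scale_mem f) (auto simp: koszul_chains_def)
  moreover have "S \<subseteq> X \<and> card S = p" if "b S - f * e S \<noteq> 0" for S
  proof -
    have "b S \<noteq> 0 \<or> e S \<noteq> 0"
      using that by auto
    then show ?thesis
      using b e(1) unfolding koszul_chains_def by blast
  qed
  ultimately have "(\<lambda>S. b S - f * e S) \<in> koszul_chains X M p"
    by (simp add: koszul_chains_def)
  moreover have "\<forall>S. koszul_d X x (\<lambda>S. b S - f * e S) S \<in> N"
    using e(2) by (simp add: koszul_d_diff koszul_d_scale)
  ultimately obtain e' where e': "e' \<in> koszul_chains X M (Suc p)"
    "\<And>S. b S - f * e S - koszul_d X x e' S \<in> N"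
    using contra unfolding koszul_homology_nonzero_def by blast
  have "b S - koszul_d X x e' S \<in> {a + f * y | a y. a \<in> N \<and> y \<in> M}" for S
  proof -
    have "b S - koszul_d X x e' S = (b S - f * e S - koszul_d X x e' S) + f * e S"
      by simp
    moreover have "e S \<in> M"
      using e(1) by (simp add: koszul_chains_def)
    ultimately show ?thesis using e'(2) by blast
  qed
  then show False using nb[OF e'(1)] by blast
qed

text \<open>Chains live on subsets of \<open>X\<close>, so those of larger degree are zero.\<close>

lemma koszul_homology_degree_le:
  assumes "finite X" "0 \<in> N" "koszul_homology_nonzero X x M N p"
  shows "p \<le> card X"
proof (rule ccontr)
  assume p: "\<not> p \<le> card X"
  obtain c where c: "c \<in> koszul_chains X M p"
    and nb: "\<And>e. e \<in> koszul_chains X M (Suc p) \<Longrightarrow> \<not> (\<forall>S. c S - koszul_d X x e S \<in> N)"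
    using assms(3) unfolding koszul_homology_nonzero_def by blast
  have "c S = 0" for S
    using c p card_mono[OF assms(1), of S] by (auto simp: koszul_chains_def)
  moreover have "(\<lambda>_. 0) \<in> koszul_chains X M (Suc p)"
    by (simp add: koszul_chains_def zero_mem)
  ultimately show False
    using nb[of "\<lambda>_. 0"] assms(2) by (simp add: koszul_d_def)
qed

text \<open>At the set \<open>X\<close> itself the differential has no index left to sum over. So
  boundaries vanish there, and \<open>z\<close> placed on \<open>X\<close> is not one modulo
  \<open>N\<close>.\<close>

lemma socle_koszul_homology:
  assumes "finite X" "subset_module R N" "z \<in> M" "z \<notin> N" "\<And>j. j \<in> X \<Longrightarrow> x j * z \<in> N"
  shows "koszul_homology_nonzero X x M N (card X)"
proof -
  interpret N: subset_module R N by (rule assms)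
  define c where "c S = (if S = X then z else 0)" for S
  have c: "c \<in> koszul_chains X M (card X)"
    using assms(3) zero_mem by (auto simp: koszul_chains_def c_def)
  have dc: "koszul_d X x c S \<in> N" for S
    unfolding koszul_d_def mult.assoc
  proof (rule N.sum_mem)
    fix j assume "j \<in> X - S"
    then show "koszul_sign j S * (x j * c (insert j S)) \<in> N"
      using assms(5) N.sign_scale_mem N.zero_mem by (simp add: c_def)
  qed
  have False if e: "e \<in> koszul_chains X M (Suc (card X))" "\<forall>S. c S - koszul_d X x e S \<in> N" for e
  proof -
    have "koszul_d X x e X = 0"
      by (simp add: koszul_d_def)
    then show False
      using e(2)[rule_format, of X] assms(4) by (simp add: c_def)
  qed
  then show ?thesis
    unfolding koszul_homology_nonzero_def using c dc by blast
qed

section \<open>Iteration along regular sequences and comparison of their lengths\<close>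

lemma subset_module_ideal_times:
  assumes "set fs \<subseteq> R"
  shows "subset_module R (ideal_times M fs) \<and> ideal_times M fs \<subseteq> M"
  using assms
proof (induction fs rule: rev_induct)
  case Nil
  show ?case
    using minus_one_scalar zero_mem by (auto simp: subset_module_def)
next
  case (snoc f fs)
  then interpret N: subset_module R "ideal_times M fs" by simp
  have sub: "ideal_times M fs \<subseteq> M" and f: "f \<in> R"
    using snoc by auto
  show ?case
  proof
    show "subset_module R (ideal_times M (fs @ [f]))"
      unfolding ideal_times_snoc
    proof
      show "0 \<in> {a + f * y | a y. a \<in> ideal_times M fs \<and> y \<in> M}"
        using N.zero_mem zero_mem by force
    next
      fix p q assume "p \<in> {a + f * y | a y. a \<in> ideal_times M fs \<and> y \<in> M}"
        "q \<in> {a + f * y | a y. a \<in> ideal_times M fs \<and> y \<in> M}"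
      then obtain a y a' y' where "p = a + f * y" "q = a' + f * y'"
        "a \<in> ideal_times M fs" "y \<in> M" "a' \<in> ideal_times M fs" "y' \<in> M"
        by blast
      moreover from this have "p + q = (a + a') + f * (y + y')"
        by (simp add: algebra_simps)
      ultimately show "p + q \<in> {a + f * y | a y. a \<in> ideal_times M fs \<and> y \<in> M}"
        using N.add_mem add_mem by blast
    next
      fix r p assume "r \<in> R" "p \<in> {a + f * y | a y. a \<in> ideal_times M fs \<and> y \<in> M}"
      then obtain a y where "p = a + f * y" "a \<in> ideal_times M fs" "y \<in> M"
        by blast
      moreover from this have "r * p = r * a + f * (r * y)"
        by (simp add: algebra_simps)
      ultimately show "r * p \<in> {a + f * y | a y. a \<in> ideal_times M fs \<and> y \<in> M}"
        using N.scale_mem scale_mem \<open>r \<in> R\<close> by blast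
    qed (rule minus_one_scalar)
    show "ideal_times M (fs @ [f]) \<subseteq> M"
      using sub f by (auto simp: ideal_times_snoc intro!: add_mem scale_mem)
  qed
qed

lemma koszul_homology_regular_sequence_up:
  assumes "finite X" "\<And>j. j \<in> X \<Longrightarrow> x j \<in> R"
    and "set fs \<subseteq> R \<inter> {\<Sum>j\<in>X. x j * g j | g. \<forall>j\<in>X. g j \<in> R}"
    and "regular_on M fs"
    and "koszul_homology_nonzero X x M {0} p"
  shows "koszul_homology_nonzero X x M (ideal_times M fs) (p + length fs)"
  using assms(3,4)
proof (induction fs rule: rev_induct)
  case Nil
  then show ?case using assms(5) by simp
next
  case (snoc f fs)
  obtain g where g: "f = (\<Sum>j\<in>X. x j * g j)" "\<And>j. j \<in> X \<Longrightarrow> g j \<in> R"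
    using snoc.prems(1) by auto
  have "set fs \<subseteq> R"
    using snoc.prems(1) by auto
  then have N: "subset_module R (ideal_times M fs)" "ideal_times M fs \<subseteq> M"
    using subset_module_ideal_times by auto
  have "koszul_homology_nonzero X x M {a + f * y | a y. a \<in> ideal_times M fs \<and> y \<in> M}
      (Suc (p + length fs))"
    by (rule koszul_homology_regular_up[OF assms(1,2) g(2,1) N])
      (use snoc in \<open>auto simp: regular_on_snoc\<close>)
  then show ?case
    by (simp add: ideal_times_snoc)
qed

text \<open>The conclusion is an inequality because a removed element may cost one degree or
  none.\<close>

lemma koszul_homology_regular_sequence_down:
  assumes "finite X" "\<And>j. j \<in> X \<Longrightarrow> x j \<in> R"
    and "set fs \<subseteq> R" "regular_on M fs"
    and "koszul_homology_nonzero X x M (ideal_times M fs) p"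
  shows "\<exists>q. p \<le> q + length fs \<and> koszul_homology_nonzero X x M {0} q"
  using assms(3-5)
proof (induction fs arbitrary: p rule: rev_induct)
  case Nil
  then show ?case by auto
next
  case (snoc f fs)
  have "set fs \<subseteq> R" "f \<in> R"
    using snoc.prems(1) by auto
  then have N: "subset_module R (ideal_times M fs)" "ideal_times M fs \<subseteq> M"
    using subset_module_ideal_times by auto
  have "koszul_homology_nonzero X x M (ideal_times M fs) p \<or>
    (\<exists>q. p = Suc q \<and> koszul_homology_nonzero X x M (ideal_times M fs) q)"
    by (rule koszul_homology_regular_down[OF assms(1,2) \<open>f \<in> R\<close> N])
      (use snoc.prems in \<open>auto simp: regular_on_snoc ideal_times_snoc\<close>)
  then obtain p' where "p \<le> Suc p'" "koszul_homology_nonzero X x M (ideal_times M fs) p'"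
    by (metis le_SucI order_refl)
  moreover from this obtain q where "p' \<le> q + length fs" "koszul_homology_nonzero X x M {0} q"
    using snoc.IH[of p'] snoc.prems by (auto simp: regular_on_snoc)
  ultimately show ?case
    by (intro exI[of _ q]) auto
qed

text \<open>From the top degree over \<open>gs\<close>, descend to a nonzero homology group of
  \<open>M\<close> in some degree \<open>q\<close> with \<open>card X \<le> q + length gs\<close>.
  Climbing along \<open>fs\<close> reaches degree \<open>q + length fs\<close>, which is at most
  \<open>card X\<close>.\<close>

theorem regular_sequence_length_le:
  fixes X :: "nat set"
  assumes X: "finite X" "\<And>j. j \<in> X \<Longrightarrow> x j \<in> R"
    and fs: "set fs \<subseteq> R \<inter> {\<Sum>j\<in>X. x j * g j | g. \<forall>j\<in>X. g j \<in> R}" "regular_on M fs"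
    and gs: "set gs \<subseteq> R" "regular_on M gs"
    and z: "z \<in> M" "z \<notin> ideal_times M gs" "\<And>j. j \<in> X \<Longrightarrow> x j * z \<in> ideal_times M gs"
  shows "length fs \<le> length gs"
proof -
  have "koszul_homology_nonzero X x M (ideal_times M gs) (card X)"
    by (rule socle_koszul_homology) (use X z subset_module_ideal_times[OF gs(1)] in auto)
  then obtain q where q: "card X \<le> q + length gs" "koszul_homology_nonzero X x M {0} q"
    using koszul_homology_regular_sequence_down[where x = x, OF X gs] by blast
  have "0 \<in> ideal_times M fs"
    using subset_module_ideal_times[of fs] fs(1) by (auto intro: subset_module.zero_mem)
  moreover have "koszul_homology_nonzero X x M (ideal_times M fs) (q + length fs)"
    by (rule koszul_homology_regular_sequence_up[where x = x, OF X fs q(2)])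
  ultimately have "q + length fs \<le> card X"
    by (rule koszul_homology_degree_le[OF X(1)])
  then show ?thesis using q(1) by simp
qed

end

section \<open>Pushforward of finitely supported maps\<close>

text \<open>Used on two levels: on exponents it substitutes variables for variables, on polynomials
  it extends a map of monomials linearly. Coefficients over the same image are added.\<close>

definition pushforward :: "('a \<Rightarrow> 'b) \<Rightarrow> ('a \<Rightarrow>\<^sub>0 'c) \<Rightarrow> ('b \<Rightarrow>\<^sub>0 'c::comm_monoid_add)" where
  "pushforward g p = (\<Sum>t\<in>Poly_Mapping.keys p. Poly_Mapping.single (g t) (Poly_Mapping.lookup p t))"

lemma pushforward_eq_sum:
  assumes "finite A" "Poly_Mapping.keys p \<subseteq> A"
  shows "pushforward g p = (\<Sum>t\<in>A. Poly_Mapping.single (g t) (Poly_Mapping.lookup p t))"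
  unfolding pushforward_def
  by (rule sum.mono_neutral_left) (use assms in \<open>auto simp: in_keys_iff\<close>)

lemma pushforward_zero [simp]: "pushforward g 0 = 0"
  by (simp add: pushforward_def)

lemma pushforward_single [simp]:
  "pushforward g (Poly_Mapping.single t c) = Poly_Mapping.single (g t) c"
  by (subst pushforward_eq_sum[of "{t}"]) auto

lemma pushforward_add: "pushforward g (p + q) = pushforward g p + pushforward g q"
proof -
  let ?A = "Poly_Mapping.keys p \<union> Poly_Mapping.keys q"
  have e: "pushforward g h = (\<Sum>t\<in>?A. Poly_Mapping.single (g t) (Poly_Mapping.lookup h t))"
    if "Poly_Mapping.keys h \<subseteq> ?A" for h
    using that by (intro pushforward_eq_sum) auto
  show ?thesis
    unfolding e[OF keys_add] e[OF Un_upper1] e[OF Un_upper2]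
    by (simp add: lookup_add single_add sum.distrib)
qed

lemma pushforward_diff:
  fixes p q :: "'a \<Rightarrow>\<^sub>0 'c::ab_group_add"
  shows "pushforward g (p - q) = pushforward g p - pushforward g q"
  using pushforward_add[of g "p - q" q] by (simp add: eq_diff_eq)

lemma pushforward_sum: "pushforward g (sum p A) = (\<Sum>a\<in>A. pushforward g (p a))"
  by (induction A rule: infinite_finite_induct) (auto simp: pushforward_add)

lemma pushforward_cong:
  "(\<And>t. t \<in> Poly_Mapping.keys p \<Longrightarrow> g t = h t) \<Longrightarrow> pushforward g p = pushforward h p"
  by (simp add: pushforward_def)

lemma pushforward_pushforward: "pushforward h (pushforward g p) = pushforward (\<lambda>t. h (g t)) p"
  by (simp add: pushforward_def[of g] pushforward_def[of "\<lambda>t. h (g t)"] pushforward_sum)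

lemma pushforward_id [simp]: "pushforward (\<lambda>t. t) p = p"
  by (rule poly_mapping_eqI)
    (auto simp: pushforward_def lookup_sum lookup_single when_def in_keys_iff sum.delta)

lemma lookup_pushforward:
  "Poly_Mapping.lookup (pushforward g p) w
    = (\<Sum>t\<in>{t \<in> Poly_Mapping.keys p. g t = w}. Poly_Mapping.lookup p t)"
  by (auto simp: pushforward_def lookup_sum lookup_single when_def simp flip: sum.inter_filter)

lemma keys_pushforward: "Poly_Mapping.keys (pushforward g p) \<subseteq> g ` Poly_Mapping.keys p"
proof
  fix w assume "w \<in> Poly_Mapping.keys (pushforward g p)"
  then have "(\<Sum>t\<in>{t \<in> Poly_Mapping.keys p. g t = w}. Poly_Mapping.lookup p t) \<noteq> 0"
    by (simp add: in_keys_iff lookup_pushforward)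
  then obtain t where "t \<in> {t \<in> Poly_Mapping.keys p. g t = w}"
    by (rule sum.not_neutral_contains_not_neutral)
  then show "w \<in> g ` Poly_Mapping.keys p"
    by auto
qed

lemma poly_mapping_sum_singles:
  "p = (\<Sum>t\<in>Poly_Mapping.keys p. Poly_Mapping.single t (Poly_Mapping.lookup p t))"
  by (rule pushforward_id[unfolded pushforward_def, symmetric])

lemma pushforward_mult:
  fixes p q :: "'a::monoid_add \<Rightarrow>\<^sub>0 'c::semiring_0"
  assumes "\<And>a b. g (a + b) = g a + g b"
  shows "pushforward g (p * q) = pushforward g p * pushforward g q"
proof -
  have "p * q = (\<Sum>a\<in>Poly_Mapping.keys p. \<Sum>b\<in>Poly_Mapping.keys q.
      Poly_Mapping.single (a + b) (Poly_Mapping.lookup p a * Poly_Mapping.lookup q b))"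
    by (subst poly_mapping_sum_singles[of p], subst poly_mapping_sum_singles[of q])
      (simp add: sum_product mult_single)
  then show ?thesis
    by (simp add: pushforward_sum assms pushforward_def[of g p] pushforward_def[of g q]
        sum_product mult_single)
qed

section \<open>Monomials and their lifts along a substitution of variables\<close>

text \<open>Induction on the total degree, dividing by one variable of the support.\<close>

lemma monomial_induct [case_names zero add]:
  fixes t :: "nat \<Rightarrow>\<^sub>0 nat"
  assumes "P 0" and "\<And>v t. P t \<Longrightarrow> P (Poly_Mapping.single v 1 + t)"
  shows "P t"
proof (induction "\<Sum>v\<in>Poly_Mapping.keys t. Poly_Mapping.lookup t v" arbitrary: t rule: less_induct)
  case less
  show ?case
  proof (cases "t = 0")
    case False
    then obtain v where v: "v \<in> Poly_Mapping.keys t"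
      by (metis all_not_in_conv keys_eq_empty)
    define t' where "t' = t - Poly_Mapping.single v 1"
    have t: "t = Poly_Mapping.single v 1 + t'"
      using v by (intro poly_mapping_eqI)
        (auto simp: t'_def lookup_add lookup_minus lookup_single when_def in_keys_iff)
    have sub: "Poly_Mapping.keys t' \<subseteq> Poly_Mapping.keys t"
      by (auto simp: t'_def in_keys_iff lookup_minus)
    have "(\<Sum>u\<in>Poly_Mapping.keys t'. Poly_Mapping.lookup t' u)
      = (\<Sum>u\<in>Poly_Mapping.keys t. Poly_Mapping.lookup t' u)"
      by (rule sum.mono_neutral_left) (use sub in \<open>auto simp: in_keys_iff\<close>)
    also have "\<dots> < (\<Sum>u\<in>Poly_Mapping.keys t. Poly_Mapping.lookup t u)"
    proof (rule sum_strict_mono_ex1)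
      show "\<exists>a\<in>Poly_Mapping.keys t. Poly_Mapping.lookup t' a < Poly_Mapping.lookup t a"
        using v by (auto simp: t'_def lookup_minus lookup_single in_keys_iff intro!: bexI[of _ v])
    qed (auto simp: t'_def lookup_minus)
    finally show ?thesis
      using less assms(2)[of t' v] t by simp
  qed (use assms in simp)
qed

definition squarefree_monomial :: "nat set \<Rightarrow> nat \<Rightarrow>\<^sub>0 nat" where
  "squarefree_monomial A = (\<Sum>v\<in>A. Poly_Mapping.single v 1)"

lemma lookup_squarefree_monomial:
  "finite A \<Longrightarrow> Poly_Mapping.lookup (squarefree_monomial A) v = (if v \<in> A then 1 else 0)"
  by (auto simp: squarefree_monomial_def lookup_sum lookup_single when_def)

lemma keys_squarefree_monomial: "finite A \<Longrightarrow> Poly_Mapping.keys (squarefree_monomial A) = A"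
  by (auto simp: in_keys_iff lookup_squarefree_monomial split: if_splits)

lemma lookup_pushforward_squarefree:
  assumes "finite A"
  shows "Poly_Mapping.lookup (pushforward g (squarefree_monomial A)) w = card {v \<in> A. g v = w}"
  using assms by (simp add: lookup_pushforward keys_squarefree_monomial lookup_squarefree_monomial)

lemma monomial_add_diff:
  fixes a b :: "nat \<Rightarrow>\<^sub>0 nat"
  assumes "\<And>v. Poly_Mapping.lookup a v \<le> Poly_Mapping.lookup b v"
  shows "a + (b - a) = b"
  using assms by (intro poly_mapping_eqI) (simp add: lookup_add lookup_minus)

lemma pushforward_fixed:
  assumes "\<And>v. v \<in> Poly_Mapping.keys t \<Longrightarrow> g v = v"
  shows "pushforward g t = t"
  using pushforward_cong[of t g "\<lambda>v. v"] assms by simp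

text \<open>Each variable in \<open>A\<close> has exponent at least one in \<open>t\<close>, and
  these exponents add up in the image.\<close>

lemma card_le_lookup_pushforward:
  assumes "A \<subseteq> Poly_Mapping.keys (t :: nat \<Rightarrow>\<^sub>0 nat)"
  shows "card {v \<in> A. g v = w} \<le> Poly_Mapping.lookup (pushforward g t) w"
proof -
  have "card {v \<in> A. g v = w} \<le> (\<Sum>v\<in>{v \<in> A. g v = w}. Poly_Mapping.lookup t v)"
    using assms by (intro order.trans[OF _ sum_bounded_below[of _ 1]]) (auto simp: in_keys_iff Suc_le_eq)
  also have "\<dots> \<le> Poly_Mapping.lookup (pushforward g t) w"
    unfolding lookup_pushforward using assms by (intro sum_mono2) auto
  finally show ?thesis .
qed

text \<open>The fibre counts say that the image of the squarefree monomial of \<open>A\<close>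
  divides \<open>\<tau>\<close>. The cofactor involves only variables fixed by \<open>g\<close>, so
  it is its own lift.\<close>

lemma pushforward_lift:
  assumes "finite A" "\<And>v. v \<in> Poly_Mapping.keys \<tau> \<Longrightarrow> g v = v"
    and "\<And>w. card {v \<in> A. g v = w} \<le> Poly_Mapping.lookup \<tau> w"
  obtains t :: "nat \<Rightarrow>\<^sub>0 nat" where "pushforward g t = \<tau>" "A \<subseteq> Poly_Mapping.keys t"
    "Poly_Mapping.keys t \<subseteq> A \<union> Poly_Mapping.keys \<tau>"
proof -
  define r where "r = \<tau> - pushforward g (squarefree_monomial A)"
  have r: "Poly_Mapping.keys r \<subseteq> Poly_Mapping.keys \<tau>"
    by (auto simp: r_def in_keys_iff lookup_minus)
  show ?thesis
  proof
    have "pushforward g r = r"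
      using r assms(2) by (intro pushforward_fixed) auto
    then show "pushforward g (squarefree_monomial A + r) = \<tau>"
      unfolding pushforward_add r_def
      using assms by (simp add: monomial_add_diff lookup_pushforward_squarefree)
    show "A \<subseteq> Poly_Mapping.keys (squarefree_monomial A + r)"
      using assms(1) by (auto simp: in_keys_iff lookup_add lookup_squarefree_monomial)
    show "Poly_Mapping.keys (squarefree_monomial A + r) \<subseteq> A \<union> Poly_Mapping.keys \<tau>"
      using keys_add[of "squarefree_monomial A" r] keys_squarefree_monomial[OF assms(1)] r by auto
  qed
qed

section \<open>Monomial ideals with nested supports\<close>

text \<open>\<open>B i\<close> is the set of variables of the \<open>i\<close>-th generator. The variables are partitioned into the
  fibres of \<open>rep\<close>, and \<open>s i\<close> is the representative of the fibre that only the \<open>i\<close>-th generator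
  contains completely.\<close>
locale nested_supports =
  fixes n k :: nat and B :: "nat \<Rightarrow> nat set" and rep s :: "nat \<Rightarrow> nat"
  assumes k_pos: "k \<ge> 1"
    and support: "i \<in> {1..k} \<Longrightarrow> B i \<subseteq> {1..n}"
    and rep_range: "v \<in> {1..n} \<Longrightarrow> rep v \<in> s ` {1..k}"
    and s_range: "i \<in> {1..k} \<Longrightarrow> s i \<in> {1..n}"
    and rep_s: "i \<in> {1..k} \<Longrightarrow> rep (s i) = s i"
    and inj_s: "inj_on s {1..k}"
    and nested: "a \<in> {1..k} \<Longrightarrow> b \<in> {1..k} \<Longrightarrow>
      {v \<in> B a. rep v = w} \<subseteq> B b \<or> {v \<in> B b. rep v = w} \<subseteq> B a"
    and fibre_subset: "i \<in> {1..k} \<Longrightarrow> {v \<in> {1..n}. rep v = s i} \<subseteq> B i"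
    and fibre_not_subset: "i \<in> {1..k} \<Longrightarrow> j \<in> {1..k} \<Longrightarrow> i \<noteq> j \<Longrightarrow>
      \<not> {v \<in> {1..n}. rep v = s i} \<subseteq> B j"
begin

section \<open>The monomial ideal and the identification of variables\<close>

definition ideal_exponents :: "(nat \<Rightarrow>\<^sub>0 nat) set" where
  "ideal_exponents = {t. Poly_Mapping.keys t \<subseteq> {1..n} \<and> (\<exists>i\<in>{1..k}. B i \<subseteq> Poly_Mapping.keys t)}"

text \<open>Described through its monomials instead of generators;
  \<open>genideal_squarefree_monomials\<close> shows that both give the same ideal.\<close>

definition monomial_ideal :: "'k::comm_ring_1 mpoly set" where
  "monomial_ideal = {p. Poly_Mapping.keys p \<subseteq> ideal_exponents}"

text \<open>\<open>V\<close> records the variables identified so far, so that the differences can be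
  divided out one at a time.\<close>

definition collapse :: "nat set \<Rightarrow> nat \<Rightarrow> nat" where
  "collapse V v = (if v \<in> V then rep v else v)"

definition identify :: "nat set \<Rightarrow> 'k::comm_ring_1 mpoly \<Rightarrow> 'k mpoly" where
  "identify V = pushforward (pushforward (collapse V))"

definition difference :: "nat \<Rightarrow> 'k::comm_ring_1 mpoly" where
  "difference v = Var v - Var (rep v)"

definition identified :: "nat set" where
  "identified = {1..n} - s ` {1..k}"

lemma identified_subset: "identified \<subseteq> {1..n}"
  by (auto simp: identified_def)

lemma finite_identified [simp]: "finite identified"
  by (simp add: identified_def)

lemma rep_in: "v \<in> {1..n} \<Longrightarrow> rep v \<in> {1..n}"
  using rep_range s_range by fastforce

lemma rep_rep: "v \<in> {1..n} \<Longrightarrow> rep (rep v) = rep v"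
  using rep_range rep_s by fastforce

lemma rep_not_identified: "v \<in> {1..n} \<Longrightarrow> rep v \<notin> identified"
  using rep_range by (auto simp: identified_def)

lemma collapse_in: "v \<in> {1..n} \<Longrightarrow> collapse V v \<in> {1..n}"
  using rep_in by (auto simp: collapse_def)

lemma collapse_collapse:
  assumes "V \<subseteq> identified" "v \<in> {1..n}"
  shows "collapse V (collapse V v) = collapse V v"
  using assms rep_not_identified[of v] by (auto simp: collapse_def)

lemma rep_collapse: "v \<in> {1..n} \<Longrightarrow> rep (collapse V v) = rep v"
  using rep_rep by (auto simp: collapse_def)

lemma keys_pushforward_collapse:
  "Poly_Mapping.keys t \<subseteq> {1..n} \<Longrightarrow> Poly_Mapping.keys (pushforward (collapse V) t) \<subseteq> {1..n}"
  using keys_pushforward[of "collapse V" t] collapse_in by fastforce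

lemma collapse_fixes_pushforward:
  assumes "V \<subseteq> identified" "Poly_Mapping.keys t \<subseteq> {1..n}"
    and "v \<in> Poly_Mapping.keys (pushforward (collapse V) t)"
  shows "collapse V v = v"
proof -
  obtain u where "v = collapse V u" "u \<in> Poly_Mapping.keys t"
    using assms(3) keys_pushforward[of "collapse V" t] by blast
  then show ?thesis
    using collapse_collapse[OF assms(1)] assms(2) by auto
qed

lemma identify_add: "identify V (p + q) = identify V p + identify V q"
  by (simp add: identify_def pushforward_add)

lemma identify_diff: "identify V (p - q) = identify V p - identify V q"
  by (simp add: identify_def pushforward_diff)

lemma identify_zero [simp]: "identify V 0 = 0"
  by (simp add: identify_def)

lemma identify_mult: "identify V (p * q) = identify V p * identify V q"
  by (simp add: identify_def pushforward_mult pushforward_add)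

lemma identify_Var [simp]: "identify V (Var v) = Var (collapse V v)"
  by (simp add: identify_def Var_def)

lemma identify_monomial [simp]:
  "identify V (Poly_Mapping.single t c) = Poly_Mapping.single (pushforward (collapse V) t) c"
  by (simp add: identify_def)

lemma subset_module_monomial_ideal:
  "subset_module (carrier (poly_ring n)) (monomial_ideal :: 'k::comm_ring_1 mpoly set)"
proof
  show "- 1 \<in> carrier (poly_ring n :: 'k mpoly ring)"
    by (simp add: poly_ring_def)
  show "0 \<in> (monomial_ideal :: 'k mpoly set)"
    by (simp add: monomial_ideal_def)
  fix p q :: "'k mpoly"
  assume q: "q \<in> monomial_ideal"
  show "p + q \<in> monomial_ideal" if "p \<in> monomial_ideal"
    using q that keys_add[of p q] by (auto simp: monomial_ideal_def)
  show "p * q \<in> monomial_ideal" if p: "p \<in> carrier (poly_ring n)"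
    unfolding monomial_ideal_def
  proof (intro CollectI subsetI)
    fix t assume "t \<in> Poly_Mapping.keys (p * q)"
    then obtain a b where t: "t = a + b" "a \<in> Poly_Mapping.keys p" "b \<in> Poly_Mapping.keys q"
      using keys_mult[of p q] by blast
    have "Poly_Mapping.keys t = Poly_Mapping.keys a \<union> Poly_Mapping.keys b"
      by (auto simp: t in_keys_iff lookup_add)
    moreover have "Poly_Mapping.keys a \<subseteq> {1..n}" "b \<in> ideal_exponents"
      using p q t by (auto simp: poly_ring_def monomial_ideal_def)
    ultimately show "t \<in> ideal_exponents"
      by (auto simp: ideal_exponents_def)
  qed
qed

lemma monomial_ideal_subset_ring: "monomial_ideal \<subseteq> carrier (poly_ring n)"
  by (auto simp: monomial_ideal_def poly_ring_def ideal_exponents_def)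

lemma monomial_in_ring:
  "Poly_Mapping.keys t \<subseteq> {1..n} \<Longrightarrow> Poly_Mapping.single t c \<in> carrier (poly_ring n)"
  by (simp add: poly_ring_def)

lemma monomial_in_ideal:
  "t \<in> ideal_exponents \<Longrightarrow> Poly_Mapping.single t c \<in> monomial_ideal"
  by (simp add: monomial_ideal_def)

lemma difference_in_ring:
  assumes "v \<in> {1..n}"
  shows "difference v \<in> (carrier (poly_ring n) :: 'k::comm_ring_1 mpoly set)"
proof -
  have "Poly_Mapping.keys (difference v :: 'k mpoly)
      \<subseteq> {Poly_Mapping.single v 1, Poly_Mapping.single (rep v) 1}"
    using keys_diff[of "Var v :: 'k mpoly" "Var (rep v)"] by (simp add: difference_def Var_def insert_commute)
  moreover have "Poly_Mapping.keys (Poly_Mapping.single u (1::nat)) \<subseteq> {1..n}" if "u \<in> {1..n}" for u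
    using that by simp
  ultimately show ?thesis
    using assms rep_in[OF assms] unfolding poly_ring_def by auto
qed

section \<open>The kernel of the identification on the ideal\<close>

text \<open>Variables are replaced one at a time. The factor \<open>u\<close> keeps every
  intermediate product inside the ideal, where \<open>diffs\<close> applies.\<close>

lemma monomial_congruence:
  fixes N :: "'k::comm_ring_1 mpoly set"
  assumes N: "subset_module (carrier (poly_ring n)) N"
    and diffs: "\<And>v y. v \<in> V \<Longrightarrow> y \<in> monomial_ideal \<Longrightarrow> difference v * y \<in> N"
    and u: "u \<in> monomial_ideal" and t: "Poly_Mapping.keys t \<subseteq> {1..n}"
  shows "(Poly_Mapping.single t 1 - Poly_Mapping.single (pushforward (collapse V) t) 1) * u \<in> N"
  using t
proof (induction t rule: monomial_induct)
  case zero
  show ?case by (simp add: subset_module.zero_mem[OF N])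
next
  case (add v t)
  interpret N: subset_module "carrier (poly_ring n)" N by (rule N)
  interpret I: subset_module "carrier (poly_ring n)" "monomial_ideal :: 'k mpoly set"
    by (rule subset_module_monomial_ideal)
  have keys: "Poly_Mapping.keys (Poly_Mapping.single v 1 + t) = insert v (Poly_Mapping.keys t)"
    by (auto simp: in_keys_iff lookup_add lookup_single when_def split: if_splits)
  then have v: "v \<in> {1..n}" and t: "Poly_Mapping.keys t \<subseteq> {1..n}"
    using add.prems by auto
  define P where "P = (Poly_Mapping.single t 1 :: 'k mpoly)"
  define Q where "Q = (Poly_Mapping.single (pushforward (collapse V) t) 1 :: 'k mpoly)"
  \<comment> \<open>With \<open>x\<close> the variable and \<open>x'\<close> its collapse, the step
    rests on \<open>x * P - x' * Q = x * (P - Q) + (x - x') * Q\<close>.\<close>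
  have "(Var v - Var (collapse V v)) * (Q * u) \<in> N"
  proof (cases "v \<in> V")
    case True
    have "Q * u \<in> monomial_ideal"
      unfolding Q_def by (intro I.scale_mem monomial_in_ring keys_pushforward_collapse t u)
    then show ?thesis
      using diffs[OF True] True by (simp add: collapse_def difference_def)
  next
    case False
    then show ?thesis by (simp add: collapse_def N.zero_mem)
  qed
  moreover have "Var v * ((P - Q) * u) \<in> N"
    unfolding P_def Q_def by (intro N.scale_mem Var_in_poly_ring v add.IH t)
  ultimately have "Var v * ((P - Q) * u) + (Var v - Var (collapse V v)) * (Q * u) \<in> N"
    by (intro N.add_mem)
  moreover have "Poly_Mapping.single (Poly_Mapping.single v 1 + t) 1 = Var v * P"
    "Poly_Mapping.single (pushforward (collapse V) (Poly_Mapping.single v 1 + t)) 1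
      = Var (collapse V v) * Q"
    by (simp_all add: P_def Q_def Var_def mult_single pushforward_add)
  ultimately show ?case
    by (simp add: algebra_simps)
qed

text \<open>Both monomials are multiples of the same generator. The cofactors have equal collapses
  because exponents can be cancelled, so each is congruent to the same monomial after multiplication
  by that generator.\<close>

lemma binomial_mem_common_support:
  fixes N :: "'k::comm_ring_1 mpoly set"
  assumes N: "subset_module (carrier (poly_ring n)) N"
    and diffs: "\<And>v y. v \<in> V \<Longrightarrow> y \<in> monomial_ideal \<Longrightarrow> difference v * y \<in> N"
    and a: "a \<in> {1..k}"
    and t: "Poly_Mapping.keys t \<subseteq> {1..n}" "B a \<subseteq> Poly_Mapping.keys t"
    and t': "Poly_Mapping.keys t' \<subseteq> {1..n}" "B a \<subseteq> Poly_Mapping.keys t'"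
    and eq: "pushforward (collapse V) t = pushforward (collapse V) t'"
  shows "Poly_Mapping.single t 1 - Poly_Mapping.single t' 1 \<in> N"
proof -
  interpret N: subset_module "carrier (poly_ring n)" N by (rule N)
  define u where "u = squarefree_monomial (B a)"
  define U where "U = (Poly_Mapping.single u 1 :: 'k mpoly)"
  have fin: "finite (B a)"
    using support[OF a] finite_subset by blast
  have U: "U \<in> monomial_ideal"
    unfolding U_def u_def using support[OF a] a
    by (intro monomial_in_ideal) (auto simp: ideal_exponents_def keys_squarefree_monomial[OF fin])
  have split: "u + (r - u) = r" if "B a \<subseteq> Poly_Mapping.keys r" for r
    using that fin
    by (intro monomial_add_diff) (auto simp: u_def lookup_squarefree_monomial in_keys_iff Suc_le_eq)
  have range: "Poly_Mapping.keys (r - u) \<subseteq> {1..n}" if "Poly_Mapping.keys r \<subseteq> {1..n}" for r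
    using that by (auto simp: in_keys_iff lookup_minus)
  have single: "Poly_Mapping.single r 1 = Poly_Mapping.single (r - u) 1 * U"
    if "B a \<subseteq> Poly_Mapping.keys r" for r
    using split[OF that] by (simp add: U_def mult_single add.commute)
  have "pushforward (collapse V) u + pushforward (collapse V) (t - u)
    = pushforward (collapse V) u + pushforward (collapse V) (t' - u)"
    unfolding pushforward_add[symmetric] split[OF t(2)] split[OF t'(2)] by (rule eq)
  then have eq': "pushforward (collapse V) (t - u) = pushforward (collapse V) (t' - u)"
    by simp
  let ?X = "\<lambda>r. Poly_Mapping.single r 1 :: 'k mpoly"
  have "(?X (t - u) - ?X (pushforward (collapse V) (t - u))) * U
      - (?X (t' - u) - ?X (pushforward (collapse V) (t' - u))) * U \<in> N"
    by (intro N.diff_mem monomial_congruence[OF N diffs U] range t t')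
  then show ?thesis
    unfolding eq' single[OF t(2)] single[OF t'(2)] by (simp add: algebra_simps)
qed

text \<open>This is where nestedness enters: \<open>collapse V\<close> maps the least common multiple of two
  generators to the least common multiple of their images, so \<open>t\<close> and \<open>t'\<close> can be joined through a
  monomial divisible by both generators.\<close>
lemma binomial_mem:
  fixes N :: "'k::comm_ring_1 mpoly set"
  assumes V: "V \<subseteq> identified"
    and N: "subset_module (carrier (poly_ring n)) N"
    and diffs: "\<And>v y. v \<in> V \<Longrightarrow> y \<in> monomial_ideal \<Longrightarrow> difference v * y \<in> N"
    and t: "t \<in> ideal_exponents" and t': "t' \<in> ideal_exponents"
    and eq: "pushforward (collapse V) t = pushforward (collapse V) t'"
  shows "Poly_Mapping.single t 1 - Poly_Mapping.single t' 1 \<in> N"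
proof -
  interpret N: subset_module "carrier (poly_ring n)" N by (rule N)
  obtain a where a: "a \<in> {1..k}" "B a \<subseteq> Poly_Mapping.keys t"
    using t by (auto simp: ideal_exponents_def)
  obtain b where b: "b \<in> {1..k}" "B b \<subseteq> Poly_Mapping.keys t'"
    using t' by (auto simp: ideal_exponents_def)
  have range: "Poly_Mapping.keys t \<subseteq> {1..n}" "Poly_Mapping.keys t' \<subseteq> {1..n}"
    using t t' by (auto simp: ideal_exponents_def)
  let ?\<tau> = "pushforward (collapse V) t"
  have AB: "B a \<union> B b \<subseteq> {1..n}"
    using support a b by blast
  \<comment> \<open>On one fibre the supports of the two generators are nested, so their union is
    one of them and its size is bounded by the exponent coming from \<open>t\<close> or from
    \<open>t'\<close>.\<close>
  have le: "card {v \<in> B a \<union> B b. collapse V v = w} \<le> Poly_Mapping.lookup ?\<tau> w" for w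
  proof -
    have "{v \<in> B c. collapse V v = w} \<subseteq> {v \<in> B c. rep v = rep w}" if "c \<in> {1..k}" for c
      using support[OF that] rep_collapse[of _ V] by auto
    then have "{v \<in> B a. collapse V v = w} \<subseteq> B b \<or> {v \<in> B b. collapse V v = w} \<subseteq> B a"
      using nested[OF a(1) b(1), of "rep w"] a(1) b(1) by (meson subset_trans)
    then have "{v \<in> B a \<union> B b. collapse V v = w} = {v \<in> B a. collapse V v = w} \<or>
      {v \<in> B a \<union> B b. collapse V v = w} = {v \<in> B b. collapse V v = w}"
      by blast
    then show ?thesis
      using card_le_lookup_pushforward[OF a(2), of "collapse V" w]
        card_le_lookup_pushforward[OF b(2), of "collapse V" w] eq by auto
  qed
  \<comment> \<open>The joining monomial: divisible by both generators, with the same collapse as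
    \<open>t\<close> and \<open>t'\<close>.\<close>
  obtain t'' where t'': "pushforward (collapse V) t'' = ?\<tau>" "B a \<union> B b \<subseteq> Poly_Mapping.keys t''"
    "Poly_Mapping.keys t'' \<subseteq> (B a \<union> B b) \<union> Poly_Mapping.keys ?\<tau>"
    by (rule pushforward_lift[of "B a \<union> B b" ?\<tau> "collapse V"])
      (use AB finite_subset le collapse_fixes_pushforward[OF V range(1)] in auto)
  have range'': "Poly_Mapping.keys t'' \<subseteq> {1..n}"
    using t''(3) AB keys_pushforward_collapse[OF range(1), of V] by blast
  have "Poly_Mapping.single t 1 - Poly_Mapping.single t'' 1 \<in> N"
    by (rule binomial_mem_common_support[OF N diffs a(1)]) (use a range range'' t'' in auto)
  moreover have "Poly_Mapping.single t'' 1 - Poly_Mapping.single t' 1 \<in> N"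
    by (rule binomial_mem_common_support[OF N diffs b(1)]) (use b range range'' t'' eq in auto)
  ultimately show ?thesis
    using N.add_mem by fastforce
qed

text \<open>An element of the kernel is a combination of binomials whose two monomials lie in the
  ideal and have the same collapse.\<close>

lemma identify_kernel_subset:
  fixes N :: "'k::comm_ring_1 mpoly set"
  assumes V: "V \<subseteq> identified"
    and N: "subset_module (carrier (poly_ring n)) N"
    and diffs: "\<And>v y. v \<in> V \<Longrightarrow> y \<in> monomial_ideal \<Longrightarrow> difference v * y \<in> N"
    and y: "y \<in> monomial_ideal" "identify V y = 0"
  shows "y \<in> N"
proof -
  interpret N: subset_module "carrier (poly_ring n)" N by (rule N)
  \<comment> \<open>One preimage in the ideal is fixed for each collapsed monomial.\<close>
  define lift where
    "lift \<tau> = (SOME t. t \<in> ideal_exponents \<and> pushforward (collapse V) t = \<tau>)" for \<tau>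
  have lift: "lift (pushforward (collapse V) t) \<in> ideal_exponents \<and>
    pushforward (collapse V) (lift (pushforward (collapse V) t)) = pushforward (collapse V) t"
    if "t \<in> ideal_exponents" for t
    unfolding lift_def by (rule someI[of _ t]) (use that in simp)
  \<comment> \<open>Replacing every monomial of \<open>y\<close> by the chosen preimage yields zero,
    so this sum may be subtracted from \<open>y\<close>.\<close>
  have "pushforward lift (identify V y) = 0"
    by (simp add: y(2))
  then have "(\<Sum>t\<in>Poly_Mapping.keys y.
      Poly_Mapping.single (lift (pushforward (collapse V) t)) (Poly_Mapping.lookup y t)) = 0"
    unfolding identify_def pushforward_pushforward by (simp add: pushforward_def)
  then have "y = (\<Sum>t\<in>Poly_Mapping.keys y. Poly_Mapping.single t (Poly_Mapping.lookup y t)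
      - Poly_Mapping.single (lift (pushforward (collapse V) t)) (Poly_Mapping.lookup y t))"
    using poly_mapping_sum_singles[of y] by (simp add: sum_subtractf)
  also have "\<dots> \<in> N"
  proof (rule N.sum_mem)
    fix t assume "t \<in> Poly_Mapping.keys y"
    then have t: "t \<in> ideal_exponents"
      using y(1) by (auto simp: monomial_ideal_def)
    let ?c = "Poly_Mapping.lookup y t"
    have "Poly_Mapping.single 0 ?c
        * (Poly_Mapping.single t 1 - Poly_Mapping.single (lift (pushforward (collapse V) t)) 1) \<in> N"
      using lift[OF t] t
      by (intro N.scale_mem monomial_in_ring binomial_mem[OF V N diffs]) auto
    then show "Poly_Mapping.single t ?c
        - Poly_Mapping.single (lift (pushforward (collapse V) t)) ?c \<in> N"
      by (simp add: right_diff_distrib mult_single)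
  qed
  finally show ?thesis .
qed

lemma collapse_rep:
  assumes "V \<subseteq> identified" "v \<in> {1..n}"
  shows "collapse V (rep v) = rep v"
  using assms rep_not_identified[of v] by (auto simp: collapse_def)

lemma subset_module_differences:
  assumes "set vs \<subseteq> {1..n}"
  shows "subset_module (carrier (poly_ring n))
    (ideal_times (monomial_ideal :: 'k::comm_ring_1 mpoly set) (map difference vs))"
  using assms
  by (intro subset_module.subset_module_ideal_times[OF subset_module_monomial_ideal, THEN conjunct1])
    (auto intro!: difference_in_ring)

lemma identify_ideal_times_differences:
  assumes "V \<subseteq> identified" "set vs \<subseteq> V"
    and "p \<in> ideal_times (monomial_ideal :: 'k::comm_ring_1 mpoly set) (map difference vs)"
  shows "identify V p = 0"
  using assms(2,3)
proof (induction vs arbitrary: p rule: rev_induct)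
  case (snoc v vs)
  then have v: "v \<in> V" "v \<in> {1..n}"
    using assms(1) identified_subset by auto
  obtain a y where "p = a + difference v * y"
    "a \<in> ideal_times (monomial_ideal :: 'k mpoly set) (map difference vs)"
    using snoc.prems(2) by (auto simp: ideal_times_snoc)
  moreover have "identify V (difference v :: 'k mpoly) = 0"
    using v collapse_rep[OF assms(1) v(2)] by (simp add: difference_def identify_diff collapse_def)
  ultimately show ?case
    using snoc.IH[of a] snoc.prems(1) by (simp add: identify_add identify_mult)
qed simp

text \<open>Consequently the quotient of the ideal by these differences is its image under
  \<open>identify\<close>, which sits inside a polynomial ring.\<close>

lemma ideal_times_differences_iff:
  fixes y :: "'k::comm_ring_1 mpoly"
  assumes vs: "set vs \<subseteq> identified" and y: "y \<in> monomial_ideal"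
  shows "y \<in> ideal_times monomial_ideal (map difference vs) \<longleftrightarrow> identify (set vs) y = 0"
proof
  show "y \<in> ideal_times monomial_ideal (map difference vs) \<Longrightarrow> identify (set vs) y = 0"
    by (rule identify_ideal_times_differences[OF vs order_refl])
  assume "identify (set vs) y = 0"
  then show "y \<in> ideal_times monomial_ideal (map difference vs)"
  proof (rule identify_kernel_subset[OF vs _ _ y, rotated -1])
    show "subset_module (carrier (poly_ring n))
        (ideal_times (monomial_ideal :: 'k mpoly set) (map difference vs))"
      using vs identified_subset by (intro subset_module_differences) auto
    show "difference v * y \<in> ideal_times monomial_ideal (map difference vs)"
      if "v \<in> set vs" "y \<in> monomial_ideal" for v and y :: "'k mpoly"
      using that subset_module.zero_mem[OF subset_module_monomial_ideal]
      by (intro ideal_times_member) auto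
  qed
qed

section \<open>Regularity of the differences and of one further variable\<close>

lemma Var_eq_iff: "(Var u :: 'k::comm_ring_1 mpoly) = Var v \<longleftrightarrow> u = v"
proof
  assume "(Var u :: 'k mpoly) = Var v"
  then have "Poly_Mapping.keys (Var u :: 'k mpoly) = Poly_Mapping.keys (Var v :: 'k mpoly)"
    by simp
  then have "Poly_Mapping.single u (1::nat) = Poly_Mapping.single v (1::nat)"
    by (simp add: Var_def)
  then have "Poly_Mapping.keys (Poly_Mapping.single u (1::nat)) = Poly_Mapping.keys (Poly_Mapping.single v (1::nat))"
    by simp
  then show "u = v"
    by simp
qed simp

lemma Var_nonzero: "(Var u :: 'k::comm_ring_1 mpoly) \<noteq> 0"
  unfolding Var_def by (metis keys_single keys_zero insert_not_empty one_neq_zero)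

text \<open>Over a field the quotient by the earlier differences embeds into a domain, where the
  next difference acts as multiplication by a nonzero polynomial.\<close>

lemma regular_on_differences:
  assumes "distinct vs" "set vs \<subseteq> identified"
  shows "regular_on (monomial_ideal :: 'k::field mpoly set) (map difference vs)"
  using assms
proof (induction vs rule: rev_induct)
  case Nil
  show ?case by (simp add: regular_on_def)
next
  case (snoc v vs)
  then have v: "v \<in> {1..n}" "v \<notin> s ` {1..k}" "v \<notin> set vs" and vs: "set vs \<subseteq> identified"
    by (auto simp: identified_def)
  \<comment> \<open>Neither \<open>v\<close> nor its representative has been identified yet, so both
    are fixed.\<close>
  have "identify (set vs) (difference v :: 'k mpoly) = Var v - Var (rep v)"
    using v collapse_rep[OF vs v(1)] by (simp add: difference_def identify_diff collapse_def)
  moreover have "v \<noteq> rep v"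
    using v rep_range by metis
  ultimately have nonzero: "identify (set vs) (difference v :: 'k mpoly) \<noteq> 0"
    by (simp add: Var_eq_iff)
  have "nonzerodivisor_mod (monomial_ideal :: 'k mpoly set)
      (ideal_times monomial_ideal (map difference vs)) (difference v)"
    unfolding nonzerodivisor_mod_def
  proof (intro ballI impI)
    fix y :: "'k mpoly"
    assume y: "y \<in> monomial_ideal"
      "difference v * y \<in> ideal_times monomial_ideal (map difference vs)"
    then have "identify (set vs) (difference v * y) = 0"
      by (intro identify_ideal_times_differences[OF vs order_refl])
    then have "identify (set vs) y = 0"
      using nonzero by (simp add: identify_mult)
    then show "y \<in> ideal_times monomial_ideal (map difference vs)"
      using ideal_times_differences_iff[OF vs y(1)] by simp
  qed
  then show ?case
    using snoc vs by (simp add: regular_on_snoc)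
qed

definition regular_parameters :: "'k::comm_ring_1 mpoly list" where
  "regular_parameters = map difference (sorted_list_of_set identified) @ [Var (s 1)]"

lemma length_regular_parameters:
  "length (regular_parameters :: 'k::comm_ring_1 mpoly list) = n - k + 1"
proof -
  have "s ` {1..k} \<subseteq> {1..n}"
    using s_range by auto
  then have "card identified = n - k"
    using card_image[OF inj_s] by (simp add: card_Diff_subset identified_def)
  then show ?thesis
    by (simp add: regular_parameters_def)
qed

lemma s_1: "s 1 \<in> {1..n}" "rep (s 1) = s 1" "collapse identified (s 1) = s 1"
  using s_range[of 1] rep_s[of 1] k_pos by (auto simp: collapse_def identified_def)

lemma regular_parameters_in_ring:
  "set regular_parameters \<subseteq> (carrier (poly_ring n) :: 'k::comm_ring_1 mpoly set)"
  using Var_in_poly_ring[OF s_1(1)] identified_subset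
  by (auto simp: regular_parameters_def intro!: difference_in_ring)

lemma regular_on_regular_parameters:
  "regular_on (monomial_ideal :: 'k::field mpoly set) regular_parameters"
proof -
  let ?vs = "sorted_list_of_set identified"
  have vs: "set ?vs \<subseteq> identified"
    by simp
  have "nonzerodivisor_mod (monomial_ideal :: 'k mpoly set)
      (ideal_times monomial_ideal (map difference ?vs)) (Var (s 1))"
    unfolding nonzerodivisor_mod_def
  proof (intro ballI impI)
    fix y :: "'k mpoly"
    assume y: "y \<in> monomial_ideal"
      "Var (s 1) * y \<in> ideal_times monomial_ideal (map difference ?vs)"
    then have "identify (set ?vs) (Var (s 1) * y) = 0"
      by (intro identify_ideal_times_differences[OF vs order_refl])
    then have "identify (set ?vs) y = 0"
      by (simp add: identify_mult Var_nonzero)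
    then show "y \<in> ideal_times monomial_ideal (map difference ?vs)"
      using ideal_times_differences_iff[OF vs y(1)] by simp
  qed
  then show ?thesis
    unfolding regular_parameters_def regular_on_snoc
    using regular_on_differences[of ?vs] by simp
qed

section \<open>The socle element\<close>

text \<open>The exponent of \<open>L / (x\<^bsub>s 1\<^esub> \<cdots> x\<^bsub>s k\<^esub>)\<close>, where \<open>L\<close> is the least common multiple of the
  images of the generators under \<open>identify\<close>; it is a socle monomial of the quotient by these
  images.\<close>
definition socle_exponent :: "nat \<Rightarrow>\<^sub>0 nat" where
  "socle_exponent = (\<Sum>j\<in>{1..k}. Poly_Mapping.single (s j) (card {v \<in> {1..n}. rep v = s j} - 1))"

lemma lookup_socle_exponent:
  assumes "i \<in> {1..k}"
  shows "Poly_Mapping.lookup socle_exponent (s i) = card {v \<in> {1..n}. rep v = s i} - 1"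
proof -
  have "Poly_Mapping.lookup socle_exponent (s i)
    = (\<Sum>j\<in>{1..k}. if j = i then card {v \<in> {1..n}. rep v = s j} - 1 else 0)"
    unfolding socle_exponent_def lookup_sum lookup_single when_def
    using assms by (intro sum.cong) (simp_all add: inj_on_eq_iff[OF inj_s])
  then show ?thesis
    using assms by simp
qed

lemma keys_socle_exponent: "Poly_Mapping.keys socle_exponent \<subseteq> s ` {1..k}"
proof
  fix w assume "w \<in> Poly_Mapping.keys socle_exponent"
  then have "w \<in> (\<Union>j\<in>{1..k}.
      Poly_Mapping.keys (Poly_Mapping.single (s j) (card {v \<in> {1..n}. rep v = s j} - 1)))"
    unfolding socle_exponent_def by (rule subsetD[OF keys_sum])
  then show "w \<in> s ` {1..k}"
    by (auto split: if_splits)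
qed

lemma pushforward_collapse_identified:
  "Poly_Mapping.keys t \<subseteq> {1..n} \<Longrightarrow> pushforward (collapse identified) t = pushforward rep t"
  using rep_s by (intro pushforward_cong) (auto simp: collapse_def identified_def)

text \<open>Generator \<open>i\<close> fills its own fibre, and the extra factor restores the
  exponent there to the full fibre size. From every other fibre it misses a variable, so size minus
  one is enough.\<close>

lemma socle_lift:
  assumes i: "i \<in> {1..k}"
  obtains t where "t \<in> ideal_exponents"
    "pushforward rep t = Poly_Mapping.single (s i) 1 + socle_exponent"
proof -
  let ?\<tau> = "Poly_Mapping.single (s i) 1 + socle_exponent"
  have keys: "Poly_Mapping.keys ?\<tau> \<subseteq> s ` {1..k}"
    using keys_add[of "Poly_Mapping.single (s i) (1::nat)" socle_exponent] keys_socle_exponent i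
    by auto
  have fin: "finite (B i)"
    using support[OF i] finite_subset by blast
  have le: "card {v \<in> B i. rep v = w} \<le> Poly_Mapping.lookup ?\<tau> w" for w
  proof (cases "w \<in> s ` {1..k}")
    case True
    then obtain j where j: "j \<in> {1..k}" "w = s j"
      by blast
    let ?F = "{v \<in> {1..n}. rep v = s j}"
    have sub: "{v \<in> B i. rep v = w} \<subseteq> ?F"
      using support[OF i] j by auto
    show ?thesis
    proof (cases "j = i")
      case True
      then have "card {v \<in> B i. rep v = w} \<le> card ?F"
        using sub by (intro card_mono) auto
      then show ?thesis
        using True j by (simp add: lookup_add lookup_socle_exponent)
    next
      case False
      then have "{v \<in> B i. rep v = w} \<subset> ?F"
        using sub fibre_not_subset[OF j(1) i False] by blast
      then have "card {v \<in> B i. rep v = w} < card ?F"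
        by (intro psubset_card_mono) auto
      then show ?thesis
        using j by (simp add: lookup_add lookup_socle_exponent)
    qed
  next
    case False
    then have "{v \<in> B i. rep v = w} = {}"
      using rep_range support[OF i] by blast
    then have "card {v \<in> B i. rep v = w} = 0"
      by (simp only: card.empty)
    then show ?thesis by (simp only: le0)
  qed
  have fixed: "rep v = v" if "v \<in> Poly_Mapping.keys ?\<tau>" for v
    using that keys rep_s by blast
  obtain t where t: "pushforward rep t = ?\<tau>" "B i \<subseteq> Poly_Mapping.keys t"
    "Poly_Mapping.keys t \<subseteq> B i \<union> Poly_Mapping.keys ?\<tau>"
    by (rule pushforward_lift[OF fin fixed le])
  have "Poly_Mapping.keys t \<subseteq> {1..n}"
    using t(3) support[OF i] keys s_range by blast
  then have "t \<in> ideal_exponents"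
    using t(2) i by (auto simp: ideal_exponents_def)
  then show ?thesis
    using t(1) that by blast
qed

text \<open>A monomial divisible by generator \<open>j\<close> has image exponent at
  \<open>s j\<close> at least the size of the whole fibre, one more than the socle monomial
  has.\<close>

lemma socle_exponent_not_image:
  assumes "t \<in> ideal_exponents"
  shows "pushforward rep t \<noteq> socle_exponent"
proof
  assume eq: "pushforward rep t = socle_exponent"
  obtain j where j: "j \<in> {1..k}" "B j \<subseteq> Poly_Mapping.keys t"
    using assms by (auto simp: ideal_exponents_def)
  let ?F = "{v \<in> {1..n}. rep v = s j}"
  have F: "{v \<in> B j. rep v = s j} = ?F"
    using fibre_subset[OF j(1)] support[OF j(1)] by auto
  have "card ?F \<le> card ?F - 1"
    using card_le_lookup_pushforward[OF j(2), of rep "s j"]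
    unfolding F eq lookup_socle_exponent[OF j(1)] .
  \<comment> \<open>The fibre contains \<open>s j\<close>, so the truncated subtraction of one
    really decreases its size.\<close>
  moreover have "card ?F > 0"
    using s_range[OF j(1)] rep_s[OF j(1)] by (auto simp: card_gt_0_iff)
  ultimately show False
    by simp
qed

text \<open>The witness \<open>Q 1\<close> lifts \<open>Var (s 1) * W\<close>, where
  \<open>W\<close> is the socle monomial. Were it zero in the quotient, cancelling
  \<open>Var (s 1)\<close> would put \<open>W\<close> into the image of the ideal.\<close>

lemma socle_element:
  obtains z :: "'k::field mpoly" where "z \<in> monomial_ideal"
    "z \<notin> ideal_times monomial_ideal regular_parameters"
    "\<And>j. j \<in> {1..n} \<Longrightarrow> Var j * z \<in> ideal_times monomial_ideal regular_parameters"
proof -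
  let ?I = "monomial_ideal :: 'k mpoly set"
  interpret I: subset_module "carrier (poly_ring n)" ?I
    by (rule subset_module_monomial_ideal)
  let ?vs = "sorted_list_of_set identified"
  have vs: "set ?vs \<subseteq> identified"
    by simp
  have times: "ideal_times ?I regular_parameters
    = {a + Var (s 1) * y | a y. a \<in> ideal_times ?I (map difference ?vs) \<and> y \<in> ?I}"
    by (simp add: regular_parameters_def ideal_times_snoc)
  have "\<forall>i\<in>{1..k}. \<exists>t. t \<in> ideal_exponents \<and>
      pushforward rep t = Poly_Mapping.single (s i) 1 + socle_exponent"
    using socle_lift by metis
  from bchoice[OF this] obtain q where q: "\<And>i. i \<in> {1..k} \<Longrightarrow> q i \<in> ideal_exponents"
    "\<And>i. i \<in> {1..k} \<Longrightarrow> pushforward rep (q i) = Poly_Mapping.single (s i) 1 + socle_exponent"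
    by blast
  define Q where "Q i = (Poly_Mapping.single (q i) 1 :: 'k mpoly)" for i
  define W where "W = (Poly_Mapping.single socle_exponent 1 :: 'k mpoly)"
  have Q: "Q i \<in> ?I" "identify identified (Q i) = Var (s i) * W" if "i \<in> {1..k}" for i
  proof -
    show "Q i \<in> ?I"
      unfolding Q_def by (intro monomial_in_ideal q that)
    have keys: "Poly_Mapping.keys (q i) \<subseteq> {1..n}"
      using q(1)[OF that] by (auto simp: ideal_exponents_def)
    show "identify identified (Q i) = Var (s i) * W"
      unfolding Q_def identify_monomial pushforward_collapse_identified[OF keys] q(2)[OF that]
      by (simp add: W_def Var_def mult_single)
  qed
  have one: "1 \<in> {1..k}"
    using k_pos by simp
  show ?thesis
  proof
    show "Q 1 \<in> ?I"
      by (rule Q(1)[OF one])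
    show "Q 1 \<notin> ideal_times ?I regular_parameters"
    proof
      assume "Q 1 \<in> ideal_times ?I regular_parameters"
      then obtain a y where ay: "Q 1 = a + Var (s 1) * y"
        "a \<in> ideal_times ?I (map difference ?vs)" "y \<in> ?I"
        unfolding times by blast
      have "identify identified a = 0"
        using identify_ideal_times_differences[OF order_refl _ ay(2)] by simp
      then have "Var (s 1) * W = Var (s 1) * identify identified y"
        unfolding Q(2)[OF one, symmetric] ay(1)
        by (simp add: identify_add identify_mult s_1(3) del: One_nat_def)
      then have "identify identified y = W"
        by (simp add: Var_nonzero)
      then have "socle_exponent \<in> Poly_Mapping.keys (identify identified y)"
        by (simp add: W_def)
      then have "socle_exponent \<in> pushforward (collapse identified) ` Poly_Mapping.keys y"
        unfolding identify_def by (rule subsetD[OF keys_pushforward])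
      then obtain t where t: "t \<in> Poly_Mapping.keys y"
        "socle_exponent = pushforward (collapse identified) t"
        by blast
      have exp: "t \<in> ideal_exponents"
        using t(1) ay(3) unfolding monomial_ideal_def by blast
      then have "pushforward (collapse identified) t = pushforward rep t"
        by (intro pushforward_collapse_identified) (simp add: ideal_exponents_def)
      then show False
        using socle_exponent_not_image[OF exp] t(2) by metis
    qed
    fix j assume j: "j \<in> {1..n}"
    then obtain i where i: "i \<in> {1..k}" "rep j = s i"
      using rep_range by blast
    have "collapse identified j = rep j"
      using j rep_s by (auto simp: collapse_def identified_def)
    \<comment> \<open>Both products collapse to \<open>Var (s 1) * Var (s i) * W\<close>, so
      \<open>Var j * Q 1\<close> is a multiple of \<open>Var (s 1)\<close> modulo the
      differences.\<close>
    then have "identify identified (Var j * Q 1 - Var (s 1) * Q i) = 0"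
      by (simp add: identify_diff identify_mult Q(2)[OF one] Q(2)[OF i(1)] i(2) s_1(3) ac_simps
          del: One_nat_def)
    moreover have "Var j * Q 1 - Var (s 1) * Q i \<in> ?I"
      by (intro I.diff_mem I.scale_mem Var_in_poly_ring j s_1(1) Q(1) one i(1))
    ultimately have "Var j * Q 1 - Var (s 1) * Q i \<in> ideal_times ?I (map difference ?vs)"
      by (intro ideal_times_differences_iff[OF vs, THEN iffD2]) (simp_all del: One_nat_def)
    moreover have "Var j * Q 1 = (Var j * Q 1 - Var (s 1) * Q i) + Var (s 1) * Q i"
      by simp
    ultimately show "Var j * Q 1 \<in> ideal_times ?I regular_parameters"
      unfolding times using Q(1)[OF i(1)] by blast
  qed
qed

end

section \<open>Ideals of the polynomial ring as modules\<close>

lemma poly_ring_simps [simp]: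
  "mult (poly_ring n) = (*)" "one (poly_ring n) = 1" "zero (poly_ring n) = 0"
  "add (poly_ring n) = (+)"
  by (simp_all add: poly_ring_def)

lemma subset_module_ideal:
  assumes "ideal I (poly_ring n :: 'k::comm_ring_1 mpoly ring)"
  shows "subset_module (carrier (poly_ring n)) I"
proof -
  interpret ideal I "poly_ring n :: 'k mpoly ring" by (rule assms)
  show ?thesis
  proof
    show "- 1 \<in> carrier (poly_ring n :: 'k mpoly ring)"
      by (simp add: poly_ring_def)
  qed (use additive_subgroup.zero_closed[OF additive_subgroup_axioms]
      additive_subgroup.a_closed[OF additive_subgroup_axioms] I_l_closed in auto)
qed

lemma ideal_subset_module:
  assumes "subset_module (carrier (poly_ring n)) I" "I \<subseteq> carrier (poly_ring n)"
  shows "ideal I (poly_ring n :: 'k::comm_ring_1 mpoly ring)"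
proof -
  interpret R: cring "poly_ring n :: 'k mpoly ring" by (rule cring_poly_ring)
  interpret I: subset_module "carrier (poly_ring n)" I by (rule assms)
  have scale: "r * p \<in> I" if "p \<in> I" "r \<in> carrier (poly_ring n)" for r p
    using I.scale_mem that by blast
  show ?thesis
  proof (rule idealI)
    show "ring (poly_ring n :: 'k mpoly ring)"
      by (rule R.ring_axioms)
    show "subgroup I (add_monoid (poly_ring n :: 'k mpoly ring))"
    proof (rule R.add.subgroupI)
      show "I \<subseteq> carrier (poly_ring n)" "I \<noteq> {}"
        using assms(2) I.zero_mem by auto
      show "p \<oplus>\<^bsub>poly_ring n\<^esub> q \<in> I" if "p \<in> I" "q \<in> I" for p q
        using I.add_mem that by simp
      show "\<ominus>\<^bsub>poly_ring n\<^esub> p \<in> I" if p: "p \<in> I" for p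
      proof -
        have pc: "p \<in> carrier (poly_ring n)"
          using assms(2) p by blast
        \<comment> \<open>The negative in the record is turned into a scalar multiple, under which
          \<open>I\<close> is closed.\<close>
        have "\<ominus>\<^bsub>poly_ring n\<^esub> p = (\<ominus>\<^bsub>poly_ring n\<^esub> \<one>\<^bsub>poly_ring n\<^esub>) \<otimes>\<^bsub>poly_ring n\<^esub> p"
          unfolding R.l_minus[OF R.one_closed pc] R.l_one[OF pc] ..
        also have "\<dots> = (\<ominus>\<^bsub>poly_ring n\<^esub> \<one>\<^bsub>poly_ring n\<^esub>) * p"
          by simp
        also have "\<dots> \<in> I"
          by (rule scale[OF p]) (rule R.a_inv_closed[OF R.one_closed])
        finally show ?thesis .
      qed
    qed
  qed (use scale in \<open>auto simp: mult.commute\<close>)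
qed

lemma finsum_ideal_module:
  assumes "ideal I (poly_ring n :: 'k::comm_ring_1 mpoly ring)" "finite A" "\<And>a. a \<in> A \<Longrightarrow> f a \<in> I"
  shows "(\<Oplus>\<^bsub>ideal_module (poly_ring n) I\<^esub>a\<in>A. f a) = sum f A"
proof -
  interpret M: Module.module "poly_ring n :: 'k mpoly ring" "ideal_module (poly_ring n) I"
    by (rule module_ideal_module[OF cring_poly_ring assms(1)])
  show ?thesis
    using assms(2,3)
  proof (induction A rule: finite_induct)
    case empty
    show ?case unfolding M.finsum_empty by (simp add: ideal_module_def)
  next
    case (insert a A)
    then have "f \<in> A \<rightarrow> carrier (ideal_module (poly_ring n) I)"
      "f a \<in> carrier (ideal_module (poly_ring n) I)"
      by (auto simp: ideal_module_def)
    then have "(\<Oplus>\<^bsub>ideal_module (poly_ring n) I\<^esub>b\<in>insert a A. f b)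
      = f a \<oplus>\<^bsub>ideal_module (poly_ring n) I\<^esub> (\<Oplus>\<^bsub>ideal_module (poly_ring n) I\<^esub>b\<in>A. f b)"
      using insert.hyps by (intro M.finsum_insert) auto
    then show ?case
      using insert by (simp add: ideal_module_def)
  qed
qed

lemma ideal_times_module_ideal_module:
  assumes I: "ideal I (poly_ring n :: 'k::comm_ring_1 mpoly ring)"
    and fs: "set fs \<subseteq> carrier (poly_ring n)"
  shows "ideal_times_module (ideal_module (poly_ring n) I) fs = ideal_times I fs"
proof -
  interpret I: subset_module "carrier (poly_ring n)" I by (rule subset_module_ideal[OF I])
  have eq: "(\<Oplus>\<^bsub>ideal_module (poly_ring n) I\<^esub>i\<in>{..<length fs}.
      fs ! i \<odot>\<^bsub>ideal_module (poly_ring n) I\<^esub> y i) = (\<Sum>i<length fs. fs ! i * y i)"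
    if "\<forall>i<length fs. y i \<in> I" for y
  proof -
    have "fs ! i * y i \<in> I" if "i \<in> {..<length fs}" for i
      using that \<open>\<forall>i<length fs. y i \<in> I\<close> fs by (intro I.scale_mem) auto
    then show ?thesis
      using finsum_ideal_module[OF I, of "{..<length fs}" "\<lambda>i. fs ! i * y i"]
      by (simp add: ideal_module_def)
  qed
  have "(y \<in> {..<length fs} \<rightarrow> carrier (ideal_module (poly_ring n) I)) = (\<forall>i<length fs. y i \<in> I)" for y
    by (auto simp: ideal_module_def)
  then show ?thesis
    unfolding ideal_times_module_def ideal_times_def using eq by (metis (no_types, lifting))
qed

lemma regular_sequence_ideal_module:
  assumes I: "ideal I (poly_ring n :: 'k::comm_ring_1 mpoly ring)"
    and fs: "set fs \<subseteq> carrier (poly_ring n)"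
  shows "regular_sequence (ideal_module (poly_ring n) I) fs \<longleftrightarrow>
    regular_on I fs \<and> ideal_times I fs \<noteq> I"
proof -
  have "ideal_times_module (ideal_module (poly_ring n) I) (take i fs) = ideal_times I (take i fs)" for i
    using set_take_subset[of i fs] fs by (intro ideal_times_module_ideal_module[OF I]) auto
  then show ?thesis
    unfolding regular_sequence_def regular_on_def nonzerodivisor_mod_def
      ideal_times_module_ideal_module[OF I fs]
    by (simp add: ideal_module_def)
qed

lemma ideal_homogeneous_maximal_ideal:
  "ideal (homogeneous_maximal_ideal n) (poly_ring n :: 'k::comm_ring_1 mpoly ring)"
proof -
  interpret cring "poly_ring n :: 'k mpoly ring" by (rule cring_poly_ring)
  show ?thesis
    unfolding homogeneous_maximal_ideal_def
    using Var_in_poly_ring by (intro genideal_ideal) blast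
qed

lemma Var_in_homogeneous_maximal_ideal:
  assumes "j \<in> {1..n}"
  shows "(Var j :: 'k::comm_ring_1 mpoly) \<in> homogeneous_maximal_ideal n"
proof -
  interpret cring "poly_ring n :: 'k mpoly ring" by (rule cring_poly_ring)
  have "Var ` {1..n} \<subseteq> carrier (poly_ring n :: 'k mpoly ring)"
    using Var_in_poly_ring by blast
  then show ?thesis
    unfolding homogeneous_maximal_ideal_def using genideal_self assms by blast
qed

text \<open>The combinations of the variables form an ideal containing them, so minimality applies.
  The coefficients obtained are those of the Koszul homotopy.\<close>

lemma homogeneous_maximal_ideal_subset:
  "homogeneous_maximal_ideal n \<subseteq> (carrier (poly_ring n) :: 'k::comm_ring_1 mpoly set) \<inter>
    {\<Sum>j\<in>{1..n}. Var j * g j | g. \<forall>j\<in>{1..n}. g j \<in> carrier (poly_ring n)}"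
proof -
  let ?R = "carrier (poly_ring n) :: 'k mpoly set"
  let ?J = "{\<Sum>j\<in>{1..n}. Var j * g j | g. \<forall>j\<in>{1..n}. g j \<in> ?R}"
  interpret R: cring "poly_ring n :: 'k mpoly ring" by (rule cring_poly_ring)
  interpret RR: subset_module ?R ?R
    by (rule subset_module_ideal[OF R.oneideal])
  have "subset_module ?R ?J"
  proof
    show "- 1 \<in> ?R" by (rule RR.minus_one_scalar)
    show "0 \<in> ?J"
      using RR.zero_mem by (intro CollectI exI[of _ "\<lambda>_. 0"]) simp
  next
    fix p q assume "p \<in> ?J" "q \<in> ?J"
    then obtain g h where "p = (\<Sum>j\<in>{1..n}. Var j * g j)" "q = (\<Sum>j\<in>{1..n}. Var j * h j)"
      and gh: "\<forall>j\<in>{1..n}. g j \<in> ?R" "\<forall>j\<in>{1..n}. h j \<in> ?R"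
      by blast
    then have "p + q = (\<Sum>j\<in>{1..n}. Var j * (g j + h j))"
      by (simp add: distrib_left sum.distrib)
    moreover have "\<forall>j\<in>{1..n}. g j + h j \<in> ?R"
      using gh RR.add_mem by blast
    ultimately show "p + q \<in> ?J" by (intro CollectI exI[of _ "\<lambda>j. g j + h j"] conjI)
  next
    fix r p assume r: "r \<in> ?R" and "p \<in> ?J"
    then obtain g where "p = (\<Sum>j\<in>{1..n}. Var j * g j)" and g: "\<forall>j\<in>{1..n}. g j \<in> ?R"
      by blast
    then have "r * p = (\<Sum>j\<in>{1..n}. Var j * (r * g j))"
      by (simp add: sum_distrib_left ac_simps)
    moreover have "\<forall>j\<in>{1..n}. r * g j \<in> ?R"
      using g r RR.scale_mem by blast
    ultimately show "r * p \<in> ?J" by (intro CollectI exI[of _ "\<lambda>j. r * g j"] conjI)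
  qed
  moreover have J: "?J \<subseteq> ?R"
    by (auto intro!: RR.sum_mem RR.scale_mem Var_in_poly_ring)
  ultimately have ideal: "ideal ?J (poly_ring n)"
    by (rule ideal_subset_module)
  have "Var i \<in> ?J" if i: "i \<in> {1..n}" for i
  proof -
    have "Var i = (\<Sum>j\<in>{1..n}. Var j * (if j = i then 1 else 0 :: 'k mpoly))"
      using i by (simp add: if_distrib cong: if_cong)
    moreover have "\<forall>j\<in>{1..n}. (if j = i then 1 else 0 :: 'k mpoly) \<in> ?R"
      using RR.zero_mem R.one_closed by auto
    ultimately show ?thesis
      by (intro CollectI exI[of _ "\<lambda>j. if j = i then 1 else 0"] conjI)
  qed
  then have "homogeneous_maximal_ideal n \<subseteq> ?J"
    unfolding homogeneous_maximal_ideal_def by (intro R.genideal_minimal[OF ideal]) auto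
  then show ?thesis using J by blast
qed

section \<open>Depth of the monomial ideal\<close>

context nested_supports
begin

text \<open>\<open>regular_parameters\<close> attains the length, and its socle element bounds all
  other sequences through \<open>regular_sequence_length_le\<close>.\<close>

theorem depth_monomial_ideal:
  "module_depth (homogeneous_maximal_ideal n)
     (ideal_module (poly_ring n) (monomial_ideal :: 'k::field mpoly set)) = enat (n - k + 1)"
proof -
  let ?I = "monomial_ideal :: 'k mpoly set"
  let ?J = "homogeneous_maximal_ideal n :: 'k mpoly set"
  interpret I: subset_module "carrier (poly_ring n)" ?I
    by (rule subset_module_monomial_ideal)
  interpret J: subset_module "carrier (poly_ring n)" ?J
    by (rule subset_module_ideal[OF ideal_homogeneous_maximal_ideal])
  have ideal: "ideal ?I (poly_ring n)"
    by (rule ideal_subset_module[OF subset_module_monomial_ideal monomial_ideal_subset_ring])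
  obtain z where z: "z \<in> ?I" "z \<notin> ideal_times ?I regular_parameters"
    "\<And>j. j \<in> {1..n} \<Longrightarrow> Var j * z \<in> ideal_times ?I regular_parameters"
    using socle_element by blast
  have "difference v \<in> ?J" if "v \<in> {1..n}" for v
    unfolding difference_def by (intro J.diff_mem Var_in_homogeneous_maximal_ideal that rep_in)
  then have "set regular_parameters \<subseteq> ?J"
    using identified_subset Var_in_homogeneous_maximal_ideal[OF s_1(1)]
    by (auto simp: regular_parameters_def)
  \<comment> \<open>The socle element also witnesses that the final quotient is nonzero.\<close>
  moreover have "regular_sequence (ideal_module (poly_ring n) ?I) regular_parameters"
    unfolding regular_sequence_ideal_module[OF ideal regular_parameters_in_ring]
    using regular_on_regular_parameters z by blast
  ultimately have "enat (n - k + 1) \<in>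
      {enat (length fs) | fs. set fs \<subseteq> ?J \<and> regular_sequence (ideal_module (poly_ring n) ?I) fs}"
    using length_regular_parameters[where ?'k = 'k]
    by (intro CollectI exI[of _ regular_parameters] conjI) auto
  moreover have "length fs \<le> n - k + 1"
    if fs: "set fs \<subseteq> ?J" "regular_sequence (ideal_module (poly_ring n) ?I) fs" for fs
  proof -
    have fs': "set fs \<subseteq> carrier (poly_ring n) \<inter>
        {\<Sum>j\<in>{1..n}. Var j * g j | g. \<forall>j\<in>{1..n}. g j \<in> carrier (poly_ring n)}"
      using fs(1) homogeneous_maximal_ideal_subset[of n] by blast
    then have "regular_on ?I fs"
      using fs(2) regular_sequence_ideal_module[OF ideal, of fs] by blast
    then have "length fs \<le> length (regular_parameters :: 'k mpoly list)"
      by (intro I.regular_sequence_length_le[where X = "{1..n}" and x = Var, OF _ _ fs' _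
            regular_parameters_in_ring regular_on_regular_parameters z])
        (auto intro!: Var_in_poly_ring)
    then show ?thesis
      by (simp add: length_regular_parameters)
  qed
  ultimately show ?thesis
    unfolding module_depth_def by (intro antisym Sup_least Sup_upper) auto
qed

text \<open>Every term of an element of \<open>monomial_ideal\<close> is divisible by one of the
  generators.\<close>

lemma genideal_squarefree_monomials:
  "genideal (poly_ring n) ((\<lambda>i. Poly_Mapping.single (squarefree_monomial (B i)) 1) ` {1..k})
    = (monomial_ideal :: 'k::comm_ring_1 mpoly set)"
proof -
  let ?g = "\<lambda>i. Poly_Mapping.single (squarefree_monomial (B i)) 1 :: 'k mpoly"
  let ?G = "genideal (poly_ring n) (?g ` {1..k})"
  interpret R: cring "poly_ring n :: 'k mpoly ring" by (rule cring_poly_ring)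
  have fin: "finite (B i)" if "i \<in> {1..k}" for i
    using support[OF that] finite_subset by blast
  have g: "?g i \<in> monomial_ideal" if "i \<in> {1..k}" for i
    using that support[OF that] keys_squarefree_monomial[OF fin[OF that]]
    by (intro monomial_in_ideal) (auto simp: ideal_exponents_def)
  have gens: "?g ` {1..k} \<subseteq> carrier (poly_ring n)"
    using g monomial_ideal_subset_ring by blast
  interpret G: subset_module "carrier (poly_ring n)" ?G
    by (rule subset_module_ideal[OF R.genideal_ideal[OF gens]])
  show ?thesis
  proof
    show "?G \<subseteq> monomial_ideal"
      using g by (intro R.genideal_minimal ideal_subset_module
          subset_module_monomial_ideal monomial_ideal_subset_ring) auto
    show "monomial_ideal \<subseteq> ?G"
    proof
      fix p :: "'k mpoly" assume p: "p \<in> monomial_ideal"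
      have "Poly_Mapping.single t c \<in> ?G" if exp: "t \<in> ideal_exponents" for t c
      proof -
        obtain i where i: "i \<in> {1..k}" "B i \<subseteq> Poly_Mapping.keys t"
          and t: "Poly_Mapping.keys t \<subseteq> {1..n}"
          using exp by (auto simp: ideal_exponents_def)
        let ?r = "t - squarefree_monomial (B i)"
        have "squarefree_monomial (B i) + ?r = t"
          using i(2) fin[OF i(1)]
          by (intro monomial_add_diff) (auto simp: lookup_squarefree_monomial in_keys_iff Suc_le_eq)
        then have "Poly_Mapping.single t c = Poly_Mapping.single ?r c * ?g i"
          by (simp add: mult_single add.commute)
        moreover have "Poly_Mapping.keys ?r \<subseteq> {1..n}"
          using t by (auto simp: in_keys_iff lookup_minus)
        moreover have "?g i \<in> ?G"
          using R.genideal_self[OF gens] i(1) by blast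
        ultimately show ?thesis
          using G.scale_mem[OF monomial_in_ring] by metis
      qed
      then have "(\<Sum>t\<in>Poly_Mapping.keys p. Poly_Mapping.single t (Poly_Mapping.lookup p t)) \<in> ?G"
        using p by (intro G.sum_mem) (auto simp: monomial_ideal_def)
      then show "p \<in> ?G"
        using poly_mapping_sum_singles[of p] by simp
    qed
  qed
qed

end

section \<open>Path ideals\<close>

lemma path_generator_eq:
  "(path_generator m l i :: 'k::comm_ring_1 mpoly)
    = Poly_Mapping.single (squarefree_monomial {(i - 1) * (m - l) + 1..(i - 1) * (m - l) + m}) 1"
proof -
  have prod: "(\<Prod>v\<in>A. Var v) = (Poly_Mapping.single (squarefree_monomial A) 1 :: 'k mpoly)"
    if "finite A" for A
    using that
    by (induction A rule: finite_induct) (auto simp: squarefree_monomial_def Var_def mult_single)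
  have "(\<Prod>j=1..m. Var (c + j)) = (\<Prod>v\<in>{c + 1..c + m}. Var v :: 'k mpoly)" for c
    by (rule prod.reindex_bij_witness[of _ "\<lambda>v. v - c" "\<lambda>j. c + j"]) auto
  then show ?thesis
    by (simp add: path_generator_def prod)
qed

text \<open>The \<open>i\<close>-th fibre is \<open>{(i - 1) * d + l + 1..i * d + l}\<close>, except that truncated subtraction also
  puts \<open>1, \<dots>, l\<close> into the first one. A fibre with \<open>i < k\<close> consists of the variables that only
  the \<open>i\<close>-th generator contains and of the \<open>l\<close> variables that it shares with the next one.\<close>
lemma nested_supports_path:
  fixes d l k :: nat
  assumes "1 \<le> k" "l < d"
  shows "nested_supports (k * d + l) k (\<lambda>i. {(i - 1) * d + 1..i * d + l})
    (\<lambda>v. ((v - l - 1) div d + 1) * d + l) (\<lambda>i. i * d + l)"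
proof -
  have d: "d > 0" using assms by simp
  \<comment> \<open>\<open>(v - l - 1) div d + 1\<close> is the number of the fibre of
    \<open>v\<close>. This fact and the next say that the first \<open>a\<close> fibres end at
    \<open>a * d + l\<close>.\<close>
  have block_le: "(v - l - 1) div d < a" if "v \<le> a * d + l" "1 \<le> a" for v a
  proof -
    have "0 < a * d" using that(2) d by simp
    then have "v - l - 1 < a * d" using that(1) by linarith
    then show ?thesis using d by (simp add: div_less_iff_less_mult)
  qed
  have block_le_iff: "(v - l - 1) div d < a \<Longrightarrow> v \<le> a * d + l" for v a
    using d by (auto simp: div_less_iff_less_mult)
  have block: "(c * d + r) div d = c" if "r < d" for c r
    using that by simp
  have pred: "(a - 1) * d + d = a * d" if "1 \<le> a" for a
    using that by (cases a) auto
  have cancel: "(a * d + l = b * d + l) = (a = b)" for a b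
    using d by simp
  \<comment> \<open>A fibre that meets the earlier generator \<open>a\<close> ends by
    \<open>a * d + l\<close>, so its elements in the later generator \<open>b\<close> lie in
    generator \<open>a\<close> too.\<close>
  have nested: "v \<in> {(a - 1) * d + 1..a * d + l}"
    if "1 \<le> a" "a < b" "u \<in> {(a - 1) * d + 1..a * d + l}" "v \<in> {(b - 1) * d + 1..b * d + l}"
      "((u - l - 1) div d + 1) * d + l = ((v - l - 1) div d + 1) * d + l" for a b u v
  proof -
    have "(u - l - 1) div d = (v - l - 1) div d"
      using that(5) unfolding cancel by simp
    then have "v \<le> a * d + l"
      using that block_le[of u a] by (intro block_le_iff) auto
    moreover have "(a - 1) * d \<le> (b - 1) * d"
      using that by (intro mult_right_mono) auto
    moreover have "(b - 1) * d + 1 \<le> v"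
      using that(4) by (simp only: atLeastAtMost_iff)
    ultimately show ?thesis
      unfolding atLeastAtMost_iff by linarith
  qed
  have fibres: "{v \<in> {(a - 1) * d + 1..a * d + l}. ((v - l - 1) div d + 1) * d + l = w} = {} \<or>
      {v \<in> {(b - 1) * d + 1..b * d + l}. ((v - l - 1) div d + 1) * d + l = w}
        \<subseteq> {(a - 1) * d + 1..a * d + l}"
    if "1 \<le> a" "a < b" for a b w
  proof (rule disjCI)
    assume "\<not> {v \<in> {(b - 1) * d + 1..b * d + l}. ((v - l - 1) div d + 1) * d + l = w}
      \<subseteq> {(a - 1) * d + 1..a * d + l}"
    then obtain v where v: "v \<in> {(b - 1) * d + 1..b * d + l}"
      "((v - l - 1) div d + 1) * d + l = w" "v \<notin> {(a - 1) * d + 1..a * d + l}"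
      by blast
    then have "((u - l - 1) div d + 1) * d + l \<noteq> w" if "u \<in> {(a - 1) * d + 1..a * d + l}" for u
      using nested[OF \<open>1 \<le> a\<close> \<open>a < b\<close> that v(1)] by metis
    then show "{v \<in> {(a - 1) * d + 1..a * d + l}. ((v - l - 1) div d + 1) * d + l = w} = {}"
      by blast
  qed
  show ?thesis
  proof
    fix i assume i: "i \<in> {1..k}"
    then have "i * d \<le> k * d" "d \<le> i * d" "1 \<le> i" by simp_all
    then have mem: "i * d + l \<in> {1..k * d + l}" "i * d \<in> {1..k * d + l}"
      unfolding atLeastAtMost_iff using d by (intro conjI; linarith)+
    show "i * d + l \<in> {1..k * d + l}"
      by (rule mem)
    show "{(i - 1) * d + 1..i * d + l} \<subseteq> {1..k * d + l}"
      using \<open>i * d \<le> k * d\<close> by auto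
    have "(i * d - 1) div d + 1 = i"
    proof -
      have eq: "i * d - 1 = (i - 1) * d + (d - 1)"
        using pred[OF \<open>1 \<le> i\<close>] d by linarith
      have "(i * d - 1) div d = i - 1"
        unfolding eq by (rule block) (use d in simp)
      then show ?thesis using \<open>1 \<le> i\<close> by simp
    qed
    then show "((i * d + l - l - 1) div d + 1) * d + l = i * d + l" by simp
    show "{v \<in> {1..k * d + l}. ((v - l - 1) div d + 1) * d + l = i * d + l}
      \<subseteq> {(i - 1) * d + 1..i * d + l}"
    proof
      fix v assume "v \<in> {v \<in> {1..k * d + l}. ((v - l - 1) div d + 1) * d + l = i * d + l}"
      then have "1 \<le> v" "(v - l - 1) div d + 1 = i"
        unfolding mem_Collect_eq cancel by simp_all
      then have v: "1 \<le> v" "(v - l - 1) div d = i - 1"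
        by linarith+
      have "(i - 1) * d \<le> v - l - 1"
        using v(2) by (metis div_times_less_eq_dividend)
      then have "(i - 1) * d + 1 \<le> v" using v(1) by linarith
      moreover have "v \<le> i * d + l"
        using v(2) i by (intro block_le_iff) auto
      ultimately show "v \<in> {(i - 1) * d + 1..i * d + l}" by simp
    qed
    fix j assume j: "j \<in> {1..k}"
    then have "1 \<le> j" by simp
    show "{v \<in> {(i - 1) * d + 1..i * d + l}. ((v - l - 1) div d + 1) * d + l = w}
        \<subseteq> {(j - 1) * d + 1..j * d + l} \<or>
      {v \<in> {(j - 1) * d + 1..j * d + l}. ((v - l - 1) div d + 1) * d + l = w}
        \<subseteq> {(i - 1) * d + 1..i * d + l}" for w
    proof (cases i j rule: linorder_cases)
      case less
      then show ?thesis
        using fibres[OF \<open>1 \<le> i\<close> less, of w] by blast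
    next
      case greater
      then show ?thesis
        using fibres[OF \<open>1 \<le> j\<close> greater, of w] by blast
    qed blast
    assume ne: "i \<noteq> j"
    \<comment> \<open>The variable \<open>i * d\<close> separates the generators: it lies in fibre
      \<open>i\<close> because \<open>l < d\<close>, after the end of generator \<open>i - 1\<close>
      and before the start of generator \<open>i + 1\<close>.\<close>
    have eq: "i * d - l - 1 = (i - 1) * d + (d - l - 1)"
      using pred[OF \<open>1 \<le> i\<close>] assms(2) by linarith
    have "(i * d - l - 1) div d = i - 1"
      unfolding eq by (rule block) (use d in simp)
    then have "(i * d - l - 1) div d + 1 = i"
      using \<open>1 \<le> i\<close> by simp
    then have "i * d \<in> {v \<in> {1..k * d + l}. ((v - l - 1) div d + 1) * d + l = i * d + l}"
      using mem(2) by (simp only: mem_Collect_eq simp_thms)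
    moreover have "i * d \<notin> {(j - 1) * d + 1..j * d + l}"
    proof (cases "j < i")
      case True
      then have "j * d \<le> (i - 1) * d" by (intro mult_right_mono) auto
      then show ?thesis
        unfolding atLeastAtMost_iff using pred[OF \<open>1 \<le> i\<close>] assms(2) by linarith
    next
      case False
      then have "i * d \<le> (j - 1) * d" using ne by (intro mult_right_mono) auto
      then show ?thesis
        unfolding atLeastAtMost_iff by linarith
    qed
    ultimately show "\<not> {v \<in> {1..k * d + l}. ((v - l - 1) div d + 1) * d + l = i * d + l}
      \<subseteq> {(j - 1) * d + 1..j * d + l}"
      by blast
  next
    fix v assume "v \<in> {1..k * d + l}"
    then have "(v - l - 1) div d < k"
      using assms(1) by (intro block_le) auto
    then show "((v - l - 1) div d + 1) * d + l \<in> (\<lambda>i. i * d + l) ` {1..k}"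
      by (intro image_eqI[of _ _ "(v - l - 1) div d + 1"]) auto
  next
    show "inj_on (\<lambda>i. i * d + l) {1..k}"
      using d by (auto simp: inj_on_def)
  qed (use assms in auto)
qed

theorem corollary3p6:
  fixes k l m n :: nat
  assumes "n = k * (m - l) + l"
    and "k \<ge> 1" and "m \<ge> 2"
    and "1 \<le> l" and "int l < \<lceil>real m / 2\<rceil>"
  shows "module_depth (homogeneous_maximal_ideal n)
           (ideal_module (poly_ring n) (path_ideal n m l k :: 'k::field mpoly set))
         = enat (n - k + 1)"
proof -
  define d where "d = m - l"
  \<comment> \<open>An integer below the ceiling of a number is below the number itself; here this
    means \<open>l < m - l\<close>.\<close>
  have "real l < real m / 2"
    using assms(5) by linarith
  then have d: "l < d" "m = d + l"
    by (auto simp: d_def)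
  have n: "n = k * d + l"
    using assms(1) by (simp add: d_def)
  interpret nested_supports n k "\<lambda>i. {(i - 1) * d + 1..i * d + l}"
    "\<lambda>v. ((v - l - 1) div d + 1) * d + l" "\<lambda>i. i * d + l"
    unfolding n using assms(2) d(1) by (rule nested_supports_path)
  have "path_generator m l i
      = (Poly_Mapping.single (squarefree_monomial {(i - 1) * d + 1..i * d + l}) 1 :: 'k mpoly)"
    if "i \<in> {1..k}" for i
  proof -
    have "(i - 1) * d + m = i * d + l"
      using that d(2) by (cases i) auto
    then show ?thesis
      by (simp add: path_generator_eq d_def[symmetric])
  qed
  then have "path_generator m l ` {1..k} = (\<lambda>i. Poly_Mapping.single
      (squarefree_monomial {(i - 1) * d + 1..i * d + l}) 1 :: 'k mpoly) ` {1..k}"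
    by (rule image_cong[OF refl])
  then have "path_ideal n m l k = (monomial_ideal :: 'k mpoly set)"
    unfolding path_ideal_def by (simp only: genideal_squarefree_monomials)
  then show ?thesis
    by (simp only: depth_monomial_ideal)
qed

end
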